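(* Let $\mathrm{UT}\mathbb{H}^2_{\mathrm{Coefs}}\subset\mathbb{RP}^3$ be the space of scaling classes of real binary cubic forms with negative discriminant. The roots map $\mathcal{R}_3$, restricted to $\mathrm{UT}\mathbb{H}^2_{\mathrm{Coefs}}$, factors as $$\mathcal{R}_3=(\mathcal{R}_1,\mathcal{R}_2)\circ(\pi_1,\pi_2),$$ where $\pi=(\pi_1,\pi_2)\colon\mathrm{UT}\mathbb{H}^2_{\mathrm{Coefs}}\to\mathbb{RP}^1_{\mathrm{Coefs}}\times\mathbb{H}^2_{\mathrm{Coefs}}$ is the trivialization of the unit tangent bundle (a homeomorphism) determined by the foliations by circles (cubics with a fixed pair of complex conjugate roots) and by hyperbolic planes (cubics with a fixed real root), i.e. $\pi_1(f)=f_1$ and $\pi_2(f)=f_2$ are the scaling classes of the real linear factor and of the irreducible real quadratic factor of $f$, and $\mathcal{R}_1,\mathcal{R}_2$ are the roots maps for linear and quadratic polynomials. Explicitly, $\mathcal{R}_3$ is the composition $$f\mapsto(f_1,f_2)\mapsto(r,z)=(\mathcal{R}_1(f_1),\mathcal{R}_2(f_2))\mapsto\{r,z,\overline z\}.$$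
   Context: Roots of binary forms are taken in $\mathbb{CP}^1=\mathbb{C}\cup\{\infty\}$ ($[z:1]\leftrightarrow z$, $[1:0]\leftrightarrow\infty$). $\mathcal{R}_3$ sends the class of a real binary cubic form $ax^3+bx^2y+cxy^2+dy^3$ with negative discriminant (hence one root in $\mathbb{RP}^1$ and one pair of non-real complex conjugate roots) to its unordered set of roots $\{r,z,\overline z\}$. $\mathbb{RP}^1_{\mathrm{Coefs}}$ is the set of scaling classes $[s:t]$ of real linear forms $sx+ty$, and $\mathcal{R}_1\colon\mathbb{RP}^1_{\mathrm{Coefs}}\to\mathbb{RP}^1_{\mathrm{Roots}}$ is $[s:t]\mapsto[-t:s]$. $\mathbb{H}^2_{\mathrm{Coefs}}=\{[a:b:c]\in\mathbb{RP}^2\mid b^2<4ac\}$ is the set of scaling classes of real quadratics with non-real roots, and $\mathcal{R}_2$ sends $[a:b:c]$ to the root of $ax^2+bx+c$ with positive imaginary part, in the upper half plane $\mathbb{H}^2_{\mathrm{Roots}}$. *)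

theory Defs
  imports "HOL-Analysis.Analysis"
begin

text \<open>A scaling class is the set of its representatives; all of them are nonzero vectors.\<close>

definition scaling_class :: "'a::real_normed_vector \<Rightarrow> 'a set" where
  "scaling_class v = {c *\<^sub>R v | c. c \<noteq> 0}"

definition RP :: "'a::real_normed_vector set set" where
  "RP = scaling_class ` (- {0})"

definition RP_topology :: "'a::real_normed_vector set topology" where
  "RP_topology = topology (\<lambda>U. U \<subseteq> RP \<and> open {v. v \<noteq> 0 \<and> scaling_class v \<in> U})"

lemma openin_RP_topology:
  "openin RP_topology U \<longleftrightarrow> U \<subseteq> RP \<and> open {v. v \<noteq> 0 \<and> scaling_class v \<in> U}"
proof -
  have "istopology (\<lambda>U::'a set set. U \<subseteq> RP \<and> open {v. v \<noteq> 0 \<and> scaling_class v \<in> U})"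
    unfolding istopology_def
  proof (rule conjI; intro allI impI)
    fix S T :: "'a set set"
    assume S: "S \<subseteq> RP \<and> open {v. v \<noteq> 0 \<and> scaling_class v \<in> S}"
      and T: "T \<subseteq> RP \<and> open {v. v \<noteq> 0 \<and> scaling_class v \<in> T}"
    have "{v. v \<noteq> 0 \<and> scaling_class v \<in> S \<inter> T} =
        {v. v \<noteq> 0 \<and> scaling_class v \<in> S} \<inter> {v. v \<noteq> 0 \<and> scaling_class v \<in> T}"
      by auto
    then show "S \<inter> T \<subseteq> RP \<and> open {v. v \<noteq> 0 \<and> scaling_class v \<in> S \<inter> T}"
      using S T by (auto simp del: mem_Collect_eq intro: open_Int)
  next
    fix K :: "'a set set set"
    assume K: "\<forall>S\<in>K. S \<subseteq> RP \<and> open {v. v \<noteq> 0 \<and> scaling_class v \<in> S}"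
    have "{v. v \<noteq> 0 \<and> scaling_class v \<in> \<Union>K} =
        (\<Union>S\<in>K. {v. v \<noteq> 0 \<and> scaling_class v \<in> S})"
      by auto
    then show "\<Union>K \<subseteq> RP \<and> open {v. v \<noteq> 0 \<and> scaling_class v \<in> \<Union>K}"
      using K by (simp add: Sup_least open_UN)
  qed
  then show ?thesis
    unfolding RP_topology_def by (simp add: topology_inverse')
qed

text \<open>Forms are given by their coefficients in decreasing powers of x.\<close>

type_synonym linear_form = "real \<times> real"
type_synonym quadratic_form = "real \<times> real \<times> real"
type_synonym cubic_form = "real \<times> real \<times> real \<times> real"

definition linear_eval :: "linear_form \<Rightarrow> complex \<Rightarrow> complex \<Rightarrow> complex" where
  "linear_eval = (\<lambda>(s, t) x y. of_real s * x + of_real t * y)"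

definition quadratic_eval :: "quadratic_form \<Rightarrow> complex \<Rightarrow> complex \<Rightarrow> complex" where
  "quadratic_eval = (\<lambda>(a, b, c) x y. of_real a * x^2 + of_real b * x * y + of_real c * y^2)"

definition cubic_eval :: "cubic_form \<Rightarrow> complex \<Rightarrow> complex \<Rightarrow> complex" where
  "cubic_eval = (\<lambda>(a, b, c, d) x y.
     of_real a * x^3 + of_real b * x^2 * y + of_real c * x * y^2 + of_real d * y^3)"

definition cubic_discriminant :: "cubic_form \<Rightarrow> real" where
  "cubic_discriminant = (\<lambda>(a, b, c, d).
     b^2 * c^2 - 4 * a * c^3 - 4 * b^3 * d - 27 * a^2 * d^2 + 18 * a * b * c * d)"

definition irreducible_quadratic :: "quadratic_form \<Rightarrow> bool" where
  "irreducible_quadratic q \<longleftrightarrow> q \<noteq> 0 \<and>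
     \<not> (\<exists>l l'. \<forall>x y. quadratic_eval q x y = linear_eval l x y * linear_eval l' x y)"

definition UTH2_Coefs :: "cubic_form set set" where
  "UTH2_Coefs = scaling_class ` {f. cubic_discriminant f < 0}"

definition RP1_Coefs :: "linear_form set set" where
  "RP1_Coefs = RP"

definition H2_Coefs :: "quadratic_form set set" where
  "H2_Coefs = scaling_class ` {(a, b, c). b^2 < 4 * a * c}"

definition CP1_class :: "complex \<times> complex \<Rightarrow> (complex \<times> complex) set" where
  "CP1_class = (\<lambda>(z, w). {(c * z, c * w) | c. c \<noteq> 0})"

definition affine_point :: "complex \<Rightarrow> (complex \<times> complex) set" where
  "affine_point z = CP1_class (z, 1)"

definition RP1_Roots :: "(real \<times> real) set set" where
  "RP1_Roots = RP"

text \<open>The inclusion of the real into the complex projective line.\<close>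

definition real_point :: "(real \<times> real) set \<Rightarrow> (complex \<times> complex) set" where
  "real_point r = {(c * of_real s, c * of_real t) | c s t. c \<noteq> 0 \<and> (s, t) \<in> r}"

definition H2_Roots :: "complex set" where
  "H2_Roots = {z. Im z > 0}"

definition R1 :: "linear_form set \<Rightarrow> (real \<times> real) set" where
  "R1 L = (\<lambda>(s, t). (- t, s)) ` L"

definition R2 :: "quadratic_form set \<Rightarrow> complex" where
  "R2 Q = (THE z. Im z > 0 \<and> (\<forall>q\<in>Q. quadratic_eval q z 1 = 0))"

text \<open>The roots of a cubic with nonzero discriminant are simple, so there they may be
  collected in a set rather than a multiset.\<close>

definition R3 :: "cubic_form set \<Rightarrow> (complex \<times> complex) set set" where
  "R3 P = {CP1_class (z, w) | z w. (z, w) \<noteq> (0, 0) \<and> (\<forall>f\<in>P. cubic_eval f z w = 0)}"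

definition unordered_roots :: "(real \<times> real) set \<times> complex \<Rightarrow> (complex \<times> complex) set set" where
  "unordered_roots = (\<lambda>(r, z). {real_point r, affine_point z, affine_point (cnj z)})"

definition factorization :: "cubic_form set \<Rightarrow> linear_form set \<Rightarrow> quadratic_form set \<Rightarrow> bool" where
  "factorization P L Q \<longleftrightarrow>
     (\<exists>f\<in>P. \<exists>l\<in>L. \<exists>q\<in>Q. \<forall>x y. cubic_eval f x y = linear_eval l x y * quadratic_eval q x y)"

definition pi1 :: "cubic_form set \<Rightarrow> linear_form set" where
  "pi1 P = (THE L. L \<in> RP \<and> (\<exists>Q\<in>RP. factorization P L Q))"

definition pi2 :: "cubic_form set \<Rightarrow> quadratic_form set" where
  "pi2 P = (THE Q. Q \<in> RP \<and> (\<forall>q\<in>Q. irreducible_quadratic q) \<and> (\<exists>L\<in>RP. factorization P L Q))"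

definition circle_leaf :: "complex \<Rightarrow> cubic_form set set" where
  "circle_leaf z = {P \<in> UTH2_Coefs. affine_point z \<in> R3 P \<and> affine_point (cnj z) \<in> R3 P}"

definition plane_leaf :: "(real \<times> real) set \<Rightarrow> cubic_form set set" where
  "plane_leaf r = {P \<in> UTH2_Coefs. real_point r \<in> R3 P}"

text \<open>Unit vectors for the metric |dz| / Im z on the upper half plane.\<close>

definition unit_tangent_bundle :: "(complex \<times> complex) set" where
  "unit_tangent_bundle = {(z, v). z \<in> H2_Roots \<and> cmod v / Im z = 1}"

text \<open>The unit speed geodesics are the images of t |-> i e^t under the orientation preserving
  isometries z |-> (a z + b) / (c z + d); such an image tends to the ideal point [a : c].
  The vector v at z points to the ideal point r if it is the initial velocity of the
  geodesic from z to r.\<close>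

definition geodesic :: "real \<Rightarrow> real \<Rightarrow> real \<Rightarrow> real \<Rightarrow> real \<Rightarrow> complex" where
  "geodesic a b c d t = (of_real a * (\<i> * of_real (exp t)) + of_real b) /
                        (of_real c * (\<i> * of_real (exp t)) + of_real d)"

definition points_to :: "complex \<Rightarrow> complex \<Rightarrow> (real \<times> real) set \<Rightarrow> bool" where
  "points_to z v r \<longleftrightarrow> (\<exists>a b c d. a * d - b * c = 1 \<and> geodesic a b c d 0 = z \<and>
     (geodesic a b c d has_vector_derivative v) (at 0) \<and> r = scaling_class (a, c))"

text \<open>The cubic with roots r, z and cnj z corresponds to the unit vector at z pointing to r.\<close>

definition unit_tangent_vector :: "cubic_form set \<Rightarrow> complex \<times> complex" where
  "unit_tangent_vector P =
     (R2 (pi2 P), THE v. points_to (R2 (pi2 P)) v (R1 (pi1 P)))"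

end

theory Submission
  imports Defs
begin

text \<open>Multiplication of forms induces a continuous map from RP1 x RP2 to RP3, hence a closed one,
  by compactness. By disc (l q) = disc q (Res (l, q))^2 the preimage of the cubics of negative
  discriminant is RP1 times the definite quadratics, and there the map is bijective; so it restricts
  to a homeomorphism, whose inverse is the pair of projections. The unit vector at z pointing to the
  ideal point [p : q] is i (Im z) (p - q z) / (p - q cnj z). For fixed z it determines [p : q], and
  every vector of length Im z arises; continuity of the inverse again comes from compactness, now of
  the fibres over z. The leaves are the fibres of the projections because a cubic is determined
  by its roots up to scaling.\<close>

section \<open>Topology of real projective spaces\<close>

text \<open>The cubics of negative discriminant, the pairs of factors and the unit vectors all form
  noncompact spaces, so a continuous bijection between them need not be a homeomorphism. For
  multiplication the remedy is that a closed map stays closed when restricted to a full preimage: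
  multiplication fails to be injective only where the quadratic factor splits, and those pairs lie
  outside the preimage. A definite form has no real zero, so the resultant never vanishes there. The
  continuity of the real root in the coefficients is thus never estimated. The direction formula
  comes from the isometry g(y) = (a y + b) / (c y + d) with ad - bc = 1 and g(i) = z: it carries the
  vector i at i to i / (c i + d)^2, while a - c z = 1 / (c i + d) and Im z = 1 / |c i + d|^2.
  Eliminating d gives an expression homogeneous of degree 0 in (a, c), hence a function of z and the
  ideal point alone.\<close>

lemma mem_scaling_class: "x \<in> scaling_class v \<longleftrightarrow> (\<exists>c. c \<noteq> 0 \<and> x = c *\<^sub>R v)"
  by (auto simp: scaling_class_def)

lemma scaling_class_self [simp]: "v \<in> scaling_class v"
  unfolding mem_scaling_class by (intro exI [of _ 1]) simp

lemma scaling_class_eq_iff: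
  "scaling_class v = scaling_class w \<longleftrightarrow> (\<exists>c. c \<noteq> 0 \<and> w = c *\<^sub>R v)"
proof
  assume eq: "scaling_class v = scaling_class w"
  have "w \<in> scaling_class w"
    by simp
  then show "\<exists>c. c \<noteq> 0 \<and> w = c *\<^sub>R v"
    by (simp flip: eq add: mem_scaling_class)
next
  assume "\<exists>c. c \<noteq> 0 \<and> w = c *\<^sub>R v"
  then obtain c where c: "c \<noteq> 0" "w = c *\<^sub>R v"
    by blast
  show "scaling_class v = scaling_class w"
  proof (rule set_eqI, unfold mem_scaling_class, rule iffI)
    fix x assume "\<exists>d. d \<noteq> 0 \<and> x = d *\<^sub>R v"
    then obtain d where "d \<noteq> 0" "x = d *\<^sub>R v"
      by blast
    with c show "\<exists>d. d \<noteq> 0 \<and> x = d *\<^sub>R w"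
      by (intro exI [of _ "d / c"]) simp
  next
    fix x assume "\<exists>d. d \<noteq> 0 \<and> x = d *\<^sub>R w"
    then obtain d where "d \<noteq> 0" "x = d *\<^sub>R w"
      by blast
    with c show "\<exists>d. d \<noteq> 0 \<and> x = d *\<^sub>R v"
      by (intro exI [of _ "d * c"]) simp
  qed
qed

lemma scaling_class_scaleR: "c \<noteq> 0 \<Longrightarrow> scaling_class (c *\<^sub>R v) = scaling_class v"
  by (metis scaling_class_eq_iff)

lemma scaling_class_in_RP [simp]: "scaling_class v \<in> RP \<longleftrightarrow> v \<noteq> 0"
  by (auto simp: RP_def scaling_class_eq_iff image_iff)

lemma RP_cases:
  assumes "P \<in> RP" obtains v where "v \<noteq> 0" "P = scaling_class v"
  using assms by (auto simp: RP_def)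

lemma topspace_RP_topology [simp]: "topspace RP_topology = (RP :: 'a::real_normed_vector set set)"
proof -
  have "{v::'a. v \<noteq> 0 \<and> scaling_class v \<in> RP} = - {0}"
    by auto
  then have "openin RP_topology (RP :: 'a set set)"
    by (simp add: openin_RP_topology open_Compl)
  then show ?thesis
    by (metis openin_RP_topology openin_subset openin_topspace subset_antisym)
qed

lemma continuous_map_scaling_class:
  "continuous_map (top_of_set (- {0})) RP_topology scaling_class"
  unfolding continuous_map_def
proof (intro conjI allI impI)
  fix U :: "'a set set"
  assume "openin RP_topology U"
  then have "open {v. v \<noteq> 0 \<and> scaling_class v \<in> U}"
    by (simp add: openin_RP_topology)
  then show "openin (top_of_set (- {0})) {v \<in> topspace (top_of_set (- {0})). scaling_class v \<in> U}"
    by (auto simp: openin_open intro!: exI [of _ "{v. v \<noteq> 0 \<and> scaling_class v \<in> U}"])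
qed auto

text \<open>The saturation of an open set is the union of its nonzero multiples, each of which is
  open. Openness is stronger than being a quotient map and is what survives products.\<close>

lemma open_map_scaling_class: "open_map (top_of_set (- {0})) RP_topology scaling_class"
  unfolding open_map_def
proof (intro allI impI)
  fix U :: "'a set"
  assume "openin (top_of_set (- {0})) U"
  then have U: "open U" "0 \<notin> U"
    by (auto simp: openin_open_eq open_Compl)
  have "{v. v \<noteq> 0 \<and> scaling_class v \<in> scaling_class ` U} = (\<Union>c\<in>-{0}. (*\<^sub>R) c ` U)"
  proof (intro equalityI subsetI)
    fix v assume "v \<in> {v. v \<noteq> 0 \<and> scaling_class v \<in> scaling_class ` U}"
    then obtain u where u: "u \<in> U" "scaling_class u = scaling_class v"
      by auto
    then show "v \<in> (\<Union>c\<in>-{0}. (*\<^sub>R) c ` U)"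
      by (auto simp: scaling_class_eq_iff)
  next
    fix v assume "v \<in> (\<Union>c\<in>-{0}. (*\<^sub>R) c ` U)"
    then obtain c u where "c \<noteq> 0" "u \<in> U" "v = c *\<^sub>R u"
      by auto
    with U show "v \<in> {v. v \<noteq> 0 \<and> scaling_class v \<in> scaling_class ` U}"
      by (auto simp: scaling_class_scaleR)
  qed
  moreover have "open (\<Union>c\<in>-{0}. (*\<^sub>R) c ` U)"
    using U(1) by (intro open_UN ballI open_scaling) auto
  ultimately show "openin RP_topology (scaling_class ` U)"
    using U(2) by (auto simp: openin_RP_topology)
qed

lemma quotient_map_scaling_class:
  "quotient_map (top_of_set (- {0})) RP_topology scaling_class"
  by (rule continuous_open_imp_quotient_map)
     (auto simp: continuous_map_scaling_class open_map_scaling_class RP_def)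

text \<open>Every class meets the unit sphere, which is compact in finite dimension.\<close>

lemma compact_space_RP: "compact_space (RP_topology :: 'a::euclidean_space set topology)"
proof -
  have "RP \<subseteq> scaling_class ` sphere (0::'a) 1"
  proof
    fix P :: "'a set" assume "P \<in> RP"
    then obtain v where v: "v \<noteq> 0" "P = scaling_class v"
      by (rule RP_cases)
    then have "P = scaling_class (inverse (norm v) *\<^sub>R v)"
      by (simp add: scaling_class_scaleR)
    then show "P \<in> scaling_class ` sphere 0 1"
      by (rule image_eqI) (simp add: v)
  qed
  then have "scaling_class ` sphere (0::'a) 1 = RP"
    by auto
  moreover have "compactin (top_of_set (- {0})) (sphere (0::'a) 1)"
    by (auto simp: compactin_subtopology)
  ultimately show ?thesis
    using image_compactin [OF _ continuous_map_scaling_class, of "sphere (0::'a) 1"]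
    by (simp add: compact_space_def)
qed

text \<open>Two classes are separated by the squared cosine of the angle to the first of them.\<close>

lemma Hausdorff_space_RP: "Hausdorff_space (RP_topology :: 'a::real_inner set topology)"
  unfolding Hausdorff_space_def
proof (intro allI impI)
  fix P Q :: "'a set"
  assume "P \<in> topspace RP_topology \<and> Q \<in> topspace RP_topology \<and> P \<noteq> Q"
  then obtain v w where v: "v \<noteq> 0" "P = scaling_class v" and w: "w \<noteq> 0" "Q = scaling_class w"
    and ne: "P \<noteq> Q"
    by (auto elim!: RP_cases)
  define g where "g u = (u \<bullet> v)\<^sup>2 / ((u \<bullet> u) * (v \<bullet> v))" for u
  have g_scale: "g (c *\<^sub>R u) = g u" if "c \<noteq> 0" for c u
    using that by (simp add: g_def power_mult_distrib power2_eq_square)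
  have gv: "g v = 1"
    using v by (simp add: g_def power2_eq_square)
  have "(w \<bullet> v)\<^sup>2 \<noteq> (w \<bullet> w) * (v \<bullet> v)"
  proof
    assume "(w \<bullet> v)\<^sup>2 = (w \<bullet> w) * (v \<bullet> v)"
    then have "\<bar>w \<bullet> v\<bar> = norm w * norm v"
      by (metis norm_eq_sqrt_inner real_sqrt_abs real_sqrt_mult)
    then have "norm w *\<^sub>R v = norm v *\<^sub>R w \<or> norm w *\<^sub>R v = - norm v *\<^sub>R w"
      by (simp add: norm_cauchy_schwarz_abs_eq)
    then have "v = (norm v / norm w) *\<^sub>R w \<or> v = (- norm v / norm w) *\<^sub>R w"
      using w(1) by (metis (no_types, opaque_lifting) divide_inverse_commute norm_eq_zero
          real_vector_affinity_eq scaleR_scaleR scaleR_one left_inverse)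
    then have "scaling_class w = scaling_class v"
      unfolding scaling_class_eq_iff using v w by (metis divide_eq_0_iff neg_equal_0_iff_equal norm_eq_zero)
    with ne v w show False
      by simp
  qed
  moreover have "(w \<bullet> v)\<^sup>2 \<le> (w \<bullet> w) * (v \<bullet> v)"
    by (rule Cauchy_Schwarz_ineq)
  ultimately have gw: "g w < 1"
    using v w by (simp add: g_def)
  then obtain m where m: "g w < m" "m < 1"
    using dense by blast
  have cont: "continuous_on (- {0}) g"
    unfolding g_def using v by (intro continuous_intros) auto
  \<comment> \<open>The sets of vectors cut out by \<open>g\<close> are open, and the class map is
    open; invariance of \<open>g\<close> under scaling later keeps the two images disjoint.\<close>
  have sep: "openin RP_topology (scaling_class ` {u. u \<noteq> 0 \<and> g u \<in> A})" if "open A" for A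
  proof -
    have "open {u. u \<noteq> 0 \<and> g u \<in> A}"
      using continuous_open_preimage [OF cont _ that] by (simp add: open_Compl vimage_def Int_def)
    then show ?thesis
      using open_map_scaling_class unfolding open_map_def
      by (auto simp: openin_open_eq open_Compl)
  qed
  show "\<exists>U V. openin RP_topology U \<and> openin RP_topology V \<and> P \<in> U \<and> Q \<in> V \<and> disjnt U V"
  proof (intro exI conjI)
    show "openin RP_topology (scaling_class ` {u. u \<noteq> 0 \<and> g u \<in> {m<..}})"
      "openin RP_topology (scaling_class ` {u. u \<noteq> 0 \<and> g u \<in> {..<m}})"
      by (rule sep; simp)+
    show "P \<in> scaling_class ` {u. u \<noteq> 0 \<and> g u \<in> {m<..}}"
      using v gv m by auto
    show "Q \<in> scaling_class ` {u. u \<noteq> 0 \<and> g u \<in> {..<m}}"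
      using w m by auto
    show "disjnt (scaling_class ` {u. u \<noteq> 0 \<and> g u \<in> {m<..}})
        (scaling_class ` {u. u \<noteq> 0 \<and> g u \<in> {..<m}})"
      by (auto simp: disjnt_iff scaling_class_eq_iff g_scale)
  qed
qed

text \<open>A product of quotient maps need not be a quotient map. For open maps it is, since an
  open box is sent to an open box.\<close>

lemma quotient_map_prod_open:
  assumes f: "continuous_map X X' f" "open_map X X' f" "f ` topspace X = topspace X'"
    and g: "continuous_map Y Y' g" "open_map Y Y' g" "g ` topspace Y = topspace Y'"
  shows "quotient_map (prod_topology X Y) (prod_topology X' Y') (map_prod f g)"
proof (rule continuous_open_imp_quotient_map)
  show "continuous_map (prod_topology X Y) (prod_topology X' Y') (map_prod f g)"
    using f g by (simp add: map_prod_def continuous_map_prod_top)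
  show "open_map (prod_topology X Y) (prod_topology X' Y') (map_prod f g)"
    unfolding open_map_def
  proof (intro allI impI)
    fix W assume W: "openin (prod_topology X Y) W"
    show "openin (prod_topology X' Y') (map_prod f g ` W)"
      unfolding openin_prod_topology_alt
    proof (intro allI impI)
      fix x' y' assume "(x', y') \<in> map_prod f g ` W"
      then obtain x y where xy: "(x, y) \<in> W" "x' = f x" "y' = g y"
        by auto
      then obtain U V where "openin X U" "openin Y V" "x \<in> U" "y \<in> V" "U \<times> V \<subseteq> W"
        using W unfolding openin_prod_topology_alt by meson
      then show "\<exists>U V. openin X' U \<and> openin Y' V \<and> x' \<in> U \<and> y' \<in> V \<and> U \<times> V \<subseteq> map_prod f g ` W"
        using f(2) g(2) xy unfolding open_map_def
        by (intro exI [of _ "f ` U"] exI [of _ "g ` V"]) auto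
    qed
  qed
  show "map_prod f g ` topspace (prod_topology X Y) = topspace (prod_topology X' Y')"
    using f g by (simp add: map_prod_surj_on)
qed

text \<open>If \<open>k\<close> inverts the pair of maps, then \<open>k (y, z)\<close> as a function
  of \<open>z\<close> inverts \<open>g\<close> on the fibre. This turns the trivialization into
  descriptions of single leaves.\<close>

lemma homeomorphic_map_fibre_fst:
  assumes h: "homeomorphic_map X (prod_topology Y Z) (\<lambda>x. (f x, g x))" and y: "y \<in> topspace Y"
  shows "homeomorphic_map (subtopology X {x \<in> topspace X. f x = y}) Z g"
proof -
  obtain k where k: "homeomorphic_maps X (prod_topology Y Z) (\<lambda>x. (f x, g x)) k"
    using h homeomorphic_map_maps by blast
  have "continuous_map X Z g"
    using k by (simp add: homeomorphic_maps_def continuous_map_paired)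
  moreover have "continuous_map Z X (k \<circ> (\<lambda>z. (y, z)))"
    using k y by (intro continuous_map_compose [of Z "prod_topology Y Z"])
      (auto simp: homeomorphic_maps_def continuous_map_paired)
  moreover have "k (y, z) \<in> topspace X" "f (k (y, z)) = y" "g (k (y, z)) = z" if "z \<in> topspace Z" for z
    using k y that by (auto simp: homeomorphic_maps_def continuous_map_def Pi_iff)
  moreover have "k (f x, g x) = x" if "x \<in> topspace X" for x
    using k that by (auto simp: homeomorphic_maps_def)
  ultimately have "homeomorphic_maps (subtopology X {x \<in> topspace X. f x = y}) Z g (k \<circ> (\<lambda>z. (y, z)))"
    by (auto simp: homeomorphic_maps_def continuous_map_in_subtopology continuous_map_from_subtopology)
  then show ?thesis
    using homeomorphic_map_maps by blast
qed

lemma homeomorphic_map_fibre_snd: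
  assumes h: "homeomorphic_map X (prod_topology Y Z) (\<lambda>x. (f x, g x))" and z: "z \<in> topspace Z"
  shows "homeomorphic_map (subtopology X {x \<in> topspace X. g x = z}) Y f"
proof (rule homeomorphic_map_fibre_fst [OF _ z])
  show "homeomorphic_map X (prod_topology Z Y) (\<lambda>x. (g x, f x))"
    using homeomorphic_map_compose [OF h homeomorphic_map_swap] by (simp add: o_def)
qed

section \<open>Factorization of cubic forms\<close>

definition form_mult :: "linear_form \<Rightarrow> quadratic_form \<Rightarrow> cubic_form" where
  "form_mult = (\<lambda>(s, t) (a, b, c). (s * a, s * b + t * a, s * c + t * b, t * c))"

definition quadratic_discriminant :: "quadratic_form \<Rightarrow> real" where
  "quadratic_discriminant = (\<lambda>(a, b, c). b\<^sup>2 - 4 * a * c)"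

text \<open>The value of the quadratic form at the root of the linear form.\<close>

definition linear_quadratic_resultant :: "linear_form \<Rightarrow> quadratic_form \<Rightarrow> real" where
  "linear_quadratic_resultant = (\<lambda>(s, t) (a, b, c). a * t\<^sup>2 - b * s * t + c * s\<^sup>2)"

text \<open>All products of representatives are taken, so no choice is involved; that they form a
  single class is proved below.\<close>

definition class_mult :: "linear_form set \<Rightarrow> quadratic_form set \<Rightarrow> cubic_form set" where
  "class_mult L Q = (\<lambda>(l, q). form_mult l q) ` (L \<times> Q)"

lemma form_mult_scaleR: "form_mult (c *\<^sub>R l) (d *\<^sub>R q) = (c * d) *\<^sub>R form_mult l q"
  by (cases l; cases q) (simp add: form_mult_def algebra_simps)

lemma class_mult_scaling_class:
  "class_mult (scaling_class l) (scaling_class q) = scaling_class (form_mult l q)"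
proof (intro equalityI subsetI)
  fix x assume "x \<in> class_mult (scaling_class l) (scaling_class q)"
  then obtain l' q' where "l' \<in> scaling_class l" "q' \<in> scaling_class q" "x = form_mult l' q'"
    unfolding class_mult_def by auto
  then obtain c d where "c \<noteq> 0" "d \<noteq> 0" "x = form_mult (c *\<^sub>R l) (d *\<^sub>R q)"
    unfolding mem_scaling_class by blast
  then show "x \<in> scaling_class (form_mult l q)"
    unfolding mem_scaling_class form_mult_scaleR by (intro exI [of _ "c * d"]) simp
next
  fix x assume "x \<in> scaling_class (form_mult l q)"
  then obtain c where c: "c \<noteq> 0" "x = c *\<^sub>R form_mult l q"
    unfolding mem_scaling_class by auto
  have "c *\<^sub>R l \<in> scaling_class l"
    unfolding mem_scaling_class using c(1) by (intro exI [of _ c]) simp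
  moreover have "1 *\<^sub>R q \<in> scaling_class q"
    by simp
  moreover have "x = form_mult (c *\<^sub>R l) (1 *\<^sub>R q)"
    unfolding form_mult_scaleR c(2) by simp
  ultimately show "x \<in> class_mult (scaling_class l) (scaling_class q)"
    unfolding class_mult_def image_iff by (intro bexI [of _ "(c *\<^sub>R l, 1 *\<^sub>R q)"]) simp_all
qed

lemma cubic_eval_form_mult:
  "cubic_eval (form_mult l q) x y = linear_eval l x y * quadratic_eval q x y"
  by (cases l; cases q)
    (simp add: form_mult_def cubic_eval_def linear_eval_def quadratic_eval_def algebra_simps power2_eq_square power3_eq_cube)

text \<open>The values at (1, 0) and (0, 1) are the outer coefficients; those at (1, 1) and (1, -1)
  then give the sum and difference of the inner ones.\<close>

lemma cubic_eval_inject: "(\<forall>x y. cubic_eval f x y = cubic_eval g x y) \<longleftrightarrow> f = g"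
proof
  obtain a b c d a' b' c' d' where f: "f = (a, b, c, d)" and g: "g = (a', b', c', d')"
    by (cases f; cases g) auto
  assume eq: "\<forall>x y. cubic_eval f x y = cubic_eval g x y"
  have 1: "complex_of_real a = of_real a'" "complex_of_real d = of_real d'"
    using eq [rule_format, of 1 0] eq [rule_format, of 0 1] by (simp_all add: f g cubic_eval_def)
  then have 2: "complex_of_real (b + c) = of_real (b' + c')" "complex_of_real (c - b) = of_real (c' - b')"
    using eq [rule_format, of 1 1] eq [rule_format, of 1 "-1"]
    by (simp_all add: f g cubic_eval_def)
  from 1 2 have "a = a'" "d = d'" "b + c = b' + c'" "c - b = c' - b'"
    unfolding of_real_eq_iff by blast+
  then show "f = g"
    by (simp add: f g)
qed simp

text \<open>Two scaling classes with a common element coincide, so one matching choice of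
  representatives already gives equality of classes.\<close>

lemma factorization_iff:
  assumes "P \<in> RP" "L \<in> RP" "Q \<in> RP"
  shows "factorization P L Q \<longleftrightarrow> P = class_mult L Q"
proof -
  obtain f l q where f: "P = scaling_class f" "L = scaling_class l" "Q = scaling_class q"
    using assms by (auto elim!: RP_cases)
  have "factorization P L Q \<longleftrightarrow> (\<exists>f\<in>P. f \<in> class_mult L Q)"
    unfolding factorization_def class_mult_def cubic_eval_form_mult [symmetric] cubic_eval_inject
    by (auto simp: image_def)
  also have "\<dots> \<longleftrightarrow> scaling_class f = scaling_class (form_mult l q)"
  proof
    assume "\<exists>g\<in>P. g \<in> class_mult L Q"
    then obtain g where "g \<in> scaling_class f" "g \<in> scaling_class (form_mult l q)"
      unfolding f class_mult_scaling_class by blast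
    then show "scaling_class f = scaling_class (form_mult l q)"
      by (metis mem_scaling_class scaling_class_scaleR)
  next
    assume "scaling_class f = scaling_class (form_mult l q)"
    moreover have "f \<in> scaling_class f"
      unfolding mem_scaling_class by (intro exI [of _ 1]) simp
    ultimately show "\<exists>g\<in>P. g \<in> class_mult L Q"
      unfolding f class_mult_scaling_class by blast
  qed
  finally show ?thesis
    by (simp add: f class_mult_scaling_class)
qed

text \<open>The discriminant of a product is the product of the discriminants times the squared
  resultant, and a linear form has discriminant 1.\<close>

lemma cubic_discriminant_form_mult:
  "cubic_discriminant (form_mult l q) =
     quadratic_discriminant q * (linear_quadratic_resultant l q)\<^sup>2"
  by (cases l; cases q)
    (simp add: form_mult_def cubic_discriminant_def quadratic_discriminant_def
      linear_quadratic_resultant_def power2_eq_square power3_eq_cube algebra_simps)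

text \<open>The discriminant has degree 4 in the coefficients; as this is even, its sign belongs to
  the class.\<close>

lemma cubic_discriminant_scaleR_neg:
  assumes "c \<noteq> 0"
  shows "cubic_discriminant (c *\<^sub>R f) < 0 \<longleftrightarrow> cubic_discriminant f < 0"
proof -
  have "cubic_discriminant (c *\<^sub>R f) = c ^ 4 * cubic_discriminant f"
    by (cases f) (simp add: cubic_discriminant_def power4_eq_xxxx power2_eq_square power3_eq_cube algebra_simps)
  moreover have "c ^ 4 > 0"
    using assms by (simp add: zero_less_power_eq)
  ultimately show ?thesis
    by (simp add: mult_less_0_iff)
qed

lemma quadratic_discriminant_scaleR_neg:
  assumes "c \<noteq> 0"
  shows "quadratic_discriminant (c *\<^sub>R q) < 0 \<longleftrightarrow> quadratic_discriminant q < 0"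
proof -
  have "quadratic_discriminant (c *\<^sub>R q) = c\<^sup>2 * quadratic_discriminant q"
    by (cases q) (simp add: quadratic_discriminant_def power2_eq_square algebra_simps)
  then show ?thesis
    using assms by (simp add: mult_less_0_iff)
qed

lemma linear_quadratic_resultant_nonzero:
  assumes "quadratic_discriminant q < 0" "l \<noteq> 0"
  shows "linear_quadratic_resultant l q \<noteq> 0"
proof
  obtain s t a b c where lq: "l = (s, t)" "q = (a, b, c)"
    by (cases l; cases q) auto
  have D: "b\<^sup>2 - 4 * a * c < 0" and st: "s \<noteq> 0 \<or> t \<noteq> 0"
    using assms by (auto simp: lq zero_prod_def quadratic_discriminant_def)
  assume "linear_quadratic_resultant l q = 0"
  then have r: "a * t\<^sup>2 - b * s * t + c * s\<^sup>2 = 0"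
    by (simp add: lq linear_quadratic_resultant_def)
  \<comment> \<open>Completing the square in either variable. Two identities are used because either
    of \<open>s\<close> and \<open>t\<close> may be zero.\<close>
  have "(2 * a * t - b * s)\<^sup>2 = (b\<^sup>2 - 4 * a * c) * s\<^sup>2" "(2 * c * s - b * t)\<^sup>2 = (b\<^sup>2 - 4 * a * c) * t\<^sup>2"
    using r by algebra+
  then have "(b\<^sup>2 - 4 * a * c) * s\<^sup>2 \<ge> 0" "(b\<^sup>2 - 4 * a * c) * t\<^sup>2 \<ge> 0"
    by (metis zero_le_power2)+
  with D st show False
    by (auto simp: zero_le_mult_iff)
qed

lemma quadratic_discriminant_zero [simp]: "quadratic_discriminant 0 = 0"
  by (simp add: zero_prod_def quadratic_discriminant_def)

lemma cubic_discriminant_zero [simp]: "cubic_discriminant 0 = 0"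
  by (simp add: zero_prod_def cubic_discriminant_def)

section \<open>Classes of negative discriminant and their products\<close>

lemma scaling_class_in_UTH2: "scaling_class f \<in> UTH2_Coefs \<longleftrightarrow> cubic_discriminant f < 0"
proof
  assume "scaling_class f \<in> UTH2_Coefs"
  then obtain g where "cubic_discriminant g < 0" "scaling_class f = scaling_class g"
    unfolding UTH2_Coefs_def by blast
  then show "cubic_discriminant f < 0"
    by (metis scaling_class_eq_iff cubic_discriminant_scaleR_neg)
qed (auto simp: UTH2_Coefs_def)

lemma H2_Coefs_eq: "H2_Coefs = scaling_class ` {q. quadratic_discriminant q < 0}"
  unfolding H2_Coefs_def
  by (rule arg_cong [of _ _ "image scaling_class"]) (auto simp: quadratic_discriminant_def)

lemma scaling_class_in_H2: "scaling_class q \<in> H2_Coefs \<longleftrightarrow> quadratic_discriminant q < 0"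
proof
  assume "scaling_class q \<in> H2_Coefs"
  then obtain r where "quadratic_discriminant r < 0" "scaling_class q = scaling_class r"
    unfolding H2_Coefs_eq by blast
  then show "quadratic_discriminant q < 0"
    by (metis scaling_class_eq_iff quadratic_discriminant_scaleR_neg)
qed (auto simp: H2_Coefs_eq)

lemma UTH2_subset_RP: "UTH2_Coefs \<subseteq> RP"
proof
  fix P assume "P \<in> UTH2_Coefs"
  then obtain f where "cubic_discriminant f < 0" "P = scaling_class f"
    unfolding UTH2_Coefs_def by blast
  then show "P \<in> RP"
    by (metis cubic_discriminant_zero less_irrefl scaling_class_in_RP)
qed

lemma H2_subset_RP: "H2_Coefs \<subseteq> RP"
proof
  fix Q assume "Q \<in> H2_Coefs"
  then obtain q where "quadratic_discriminant q < 0" "Q = scaling_class q"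
    unfolding H2_Coefs_eq by blast
  then show "Q \<in> RP"
    by (metis quadratic_discriminant_zero less_irrefl scaling_class_in_RP)
qed

lemma form_mult_nonzero:
  assumes "l \<noteq> 0" "q \<noteq> 0"
  shows "form_mult l q \<noteq> 0"
  using assms by (cases l; cases q) (auto simp: zero_prod_def form_mult_def)

lemma class_mult_in_RP: "L \<in> RP \<Longrightarrow> Q \<in> RP \<Longrightarrow> class_mult L Q \<in> RP"
  by (metis RP_cases class_mult_scaling_class form_mult_nonzero scaling_class_in_RP)

text \<open>The sign of the product discriminant is that of the quadratic one as soon as the
  resultant is nonzero, which definiteness guarantees. This identifies the full preimage over which
  multiplication is restricted.\<close>

lemma class_mult_in_UTH2_iff:
  assumes "L \<in> RP" "Q \<in> RP"
  shows "class_mult L Q \<in> UTH2_Coefs \<longleftrightarrow> Q \<in> H2_Coefs"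
proof -
  obtain l q where "l \<noteq> 0" "L = scaling_class l" "Q = scaling_class q"
    using assms by (auto elim!: RP_cases)
  then show ?thesis
    using linear_quadratic_resultant_nonzero [of q l]
    by (auto simp: class_mult_scaling_class scaling_class_in_UTH2 scaling_class_in_H2
        cubic_discriminant_form_mult mult_less_0_iff)
qed

text \<open>At the real zero of \<open>l\<close> the product of \<open>l'\<close> and
  \<open>q'\<close> vanishes; as \<open>q'\<close> is definite, \<open>l'\<close> must vanish there.
  The linear forms are thus proportional and can be cancelled.\<close>

lemma class_mult_inject:
  assumes "L \<in> RP" "L' \<in> RP" "Q \<in> H2_Coefs" "Q' \<in> H2_Coefs"
    and eq: "class_mult L Q = class_mult L' Q'"
  shows "L = L' \<and> Q = Q'"
proof -
  obtain l l' q q' where l: "l \<noteq> 0" "L = scaling_class l" "l' \<noteq> 0" "L' = scaling_class l'"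
    and q: "quadratic_discriminant q < 0" "Q = scaling_class q"
           "quadratic_discriminant q' < 0" "Q' = scaling_class q'"
    using assms by (auto elim!: RP_cases simp: H2_Coefs_eq)
  obtain k where k: "k \<noteq> 0" "form_mult l' q' = k *\<^sub>R form_mult l q"
    using eq by (auto simp: l q class_mult_scaling_class scaling_class_eq_iff)
  obtain s t s' t' a b c a' b' c' where
    st: "l = (s, t)" "l' = (s', t')" and abc: "q = (a, b, c)" "q' = (a', b', c')"
    by (cases l; cases l'; cases q; cases q') auto
  have e: "s' * a' = k * (s * a)" "s' * b' + t' * a' = k * (s * b + t * a)"
    "s' * c' + t' * b' = k * (s * c + t * b)" "t' * c' = k * (t * c)"
    using k by (simp_all add: st abc form_mult_def)
  \<comment> \<open>Both sides are the value of \<open>form_mult l' q'\<close> at the zero (t, -s)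
    of \<open>l\<close>.\<close>
  have "(s' * t - t' * s) * linear_quadratic_resultant l q' =
      t ^ 3 * (s' * a') - t\<^sup>2 * s * (s' * b' + t' * a') + t * s\<^sup>2 * (s' * c' + t' * b') - s ^ 3 * (t' * c')"
    by (simp add: st abc linear_quadratic_resultant_def algebra_simps power2_eq_square power3_eq_cube)
  also have "\<dots> = 0"
    unfolding e by (simp add: algebra_simps power2_eq_square power3_eq_cube)
  finally have "(s' * t - t' * s) * linear_quadratic_resultant l q' = 0" .
  then have "s' * t = t' * s"
    using linear_quadratic_resultant_nonzero [OF q(3) l(1)] by simp
  moreover have "s \<noteq> 0 \<or> t \<noteq> 0" "s' \<noteq> 0 \<or> t' \<noteq> 0"
    using l by (auto simp: st zero_prod_def)
  ultimately obtain m where m: "m \<noteq> 0" "s' = m * s" "t' = m * t"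
  proof (cases "s = 0")
    case True
    with \<open>s' * t = t' * s\<close> \<open>s \<noteq> 0 \<or> t \<noteq> 0\<close> \<open>s' \<noteq> 0 \<or> t' \<noteq> 0\<close> show ?thesis
      by (intro that [of "t' / t"]) auto
  next
    case False
    with \<open>s' * t = t' * s\<close> \<open>s' \<noteq> 0 \<or> t' \<noteq> 0\<close> show ?thesis
      by (intro that [of "s' / s"]) (auto simp: field_simps)
  qed
  \<comment> \<open>Cancellation of the linear form: all coefficients at once if it is a multiple of
    y, otherwise successively from the leading one down.\<close>
  have "m * a' = k * a \<and> m * b' = k * b \<and> m * c' = k * c"
  proof (cases "s = 0")
    case True
    then have "t \<noteq> 0" using \<open>s \<noteq> 0 \<or> t \<noteq> 0\<close> by simp
    then have "t * (m * a') = t * (k * a)" "t * (m * b') = t * (k * b)" "t * (m * c') = t * (k * c)"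
      using e by (simp_all add: m True algebra_simps)
    with \<open>t \<noteq> 0\<close> show ?thesis
      by simp
  next
    case False
    have "s * (m * a') = s * (k * a)"
      using e(1) by (simp add: m algebra_simps)
    then have 1: "m * a' = k * a"
      using False by simp
    have "s * (m * b') = (m * s * b' + m * t * a') - t * (m * a')"
      by (simp add: algebra_simps)
    also have "\<dots> = k * (s * b + t * a) - t * (k * a)"
      using e(2) by (simp only: m 1)
    also have "\<dots> = s * (k * b)"
      by (simp add: algebra_simps)
    finally have "s * (m * b') = s * (k * b)" .
    then have 2: "m * b' = k * b"
      using False by simp
    have "s * (m * c') = (m * s * c' + m * t * b') - t * (m * b')"
      by (simp add: algebra_simps)
    also have "\<dots> = k * (s * c + t * b) - t * (k * b)"
      using e(3) by (simp only: m 2)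
    also have "\<dots> = s * (k * c)"
      by (simp add: algebra_simps)
    finally have "s * (m * c') = s * (k * c)" .
    with 1 2 False show ?thesis
      by simp
  qed
  then have "q' = (k / m) *\<^sub>R q"
    using m by (simp add: abc field_simps)
  moreover have "l' = m *\<^sub>R l"
    by (simp add: st m)
  ultimately show ?thesis
    using k m by (simp add: l q scaling_class_scaleR)
qed

lemma cubic_real_root:
  fixes b c d :: real
  shows "\<exists>r. r ^ 3 + b * r\<^sup>2 + c * r + d = 0"
proof -
  define g where "g r = r ^ 3 + b * r\<^sup>2 + c * r + d" for r
  \<comment> \<open>A Cauchy-type bound: at |r| = M the lower terms are at most (M - 1) M^2, so the
    cubic term decides the sign at both ends.\<close>
  define M where "M = 1 + \<bar>b\<bar> + \<bar>c\<bar> + \<bar>d\<bar>"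
  have M: "M \<ge> 1"
    by (simp add: M_def)
  have "\<bar>b * r\<^sup>2 + c * r + d\<bar> \<le> M ^ 3" if "\<bar>r\<bar> = M" for r
  proof -
    have "\<bar>b * r\<^sup>2 + c * r + d\<bar> \<le> \<bar>b * r\<^sup>2\<bar> + \<bar>c * r\<bar> + \<bar>d\<bar>"
      by linarith
    also have "\<dots> = \<bar>b\<bar> * M\<^sup>2 + \<bar>c\<bar> * M + \<bar>d\<bar> * 1"
      by (simp add: abs_mult flip: that)
    also have "\<dots> \<le> \<bar>b\<bar> * M\<^sup>2 + \<bar>c\<bar> * M\<^sup>2 + \<bar>d\<bar> * M\<^sup>2"
      using M by (intro add_mono mult_left_mono) (auto simp: power2_eq_square mult_le_cancel_left1 intro: order_trans [OF M])
    also have "\<dots> = (M - 1) * M\<^sup>2"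
      by (simp add: M_def algebra_simps)
    also have "\<dots> \<le> M * M\<^sup>2"
      using M by (intro mult_right_mono) auto
    finally show ?thesis
      by (simp add: power2_eq_square power3_eq_cube)
  qed
  from this [of M] this [of "- M"] have "g (- M) \<le> 0" "0 \<le> g M"
    using M by (auto simp: g_def power3_eq_cube)
  moreover have "continuous_on {-M..M} g"
    unfolding g_def by (intro continuous_intros)
  ultimately obtain r where "g r = 0"
    using IVT' [of g "-M" 0 M] M by auto
  then show ?thesis
    by (auto simp: g_def)
qed

text \<open>If the leading coefficient vanishes, infinity is a root and y splits off. Otherwise
  division by x - r y, for a real root r, leaves the Horner coefficients as quotient.\<close>

lemma cubic_form_factorization: "\<exists>l q. l \<noteq> 0 \<and> f = form_mult l q"
proof -
  obtain a b c d where f: "f = (a, b, c, d)"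
    by (cases f) auto
  show ?thesis
  proof (cases "a = 0")
    case True
    then show ?thesis
      by (intro exI [of _ "(0, 1)"] exI [of _ "(b, c, d)"]) (simp add: f zero_prod_def form_mult_def)
  next
    case False
    obtain r where "r ^ 3 + b / a * r\<^sup>2 + c / a * r + d / a = 0"
      using cubic_real_root by blast
    then have "a * r ^ 3 + b * r\<^sup>2 + c * r + d = 0"
      using False by (simp add: field_simps)
    then show ?thesis
      by (intro exI [of _ "(1, - r)"] exI [of _ "(a, b + a * r, c + b * r + a * r\<^sup>2)"])
        (simp add: f zero_prod_def form_mult_def algebra_simps power2_eq_square power3_eq_cube)
  qed
qed

lemma UTH2_cases:
  assumes "P \<in> UTH2_Coefs"
  obtains L Q where "L \<in> RP" "Q \<in> H2_Coefs" "P = class_mult L Q"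
proof -
  obtain f where f: "P = scaling_class f" "cubic_discriminant f < 0"
    using assms by (auto simp: UTH2_Coefs_def)
  obtain l q where lq: "l \<noteq> 0" "f = form_mult l q"
    using cubic_form_factorization by blast
  then have "quadratic_discriminant q < 0"
    using f(2) by (auto simp: cubic_discriminant_form_mult mult_less_0_iff)
  then show ?thesis
    using lq f(1) by (intro that [of "scaling_class l" "scaling_class q"])
      (simp_all add: scaling_class_in_H2 class_mult_scaling_class)
qed

text \<open>This links the definition of \<open>pi2\<close>, phrased by irreducibility over the
  reals, with the sign condition that defines \<open>H2_Coefs\<close>.\<close>

lemma irreducible_quadratic_iff: "irreducible_quadratic q \<longleftrightarrow> quadratic_discriminant q < 0"
proof -
  obtain a b c where q: "q = (a, b, c)"
    by (cases q) auto
  show ?thesis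
  proof
    assume irr: "irreducible_quadratic q"
    show "quadratic_discriminant q < 0"
    proof (rule ccontr)
      assume "\<not> quadratic_discriminant q < 0"
      then have D: "b\<^sup>2 - 4 * a * c \<ge> 0"
        by (simp add: q quadratic_discriminant_def)
      have "\<exists>l l'. \<forall>x y. quadratic_eval q x y = linear_eval l x y * linear_eval l' x y"
      proof (cases "a = 0")
        case True
        then show ?thesis
          by (intro exI [of _ "(0, 1)"] exI [of _ "(b, c)"])
            (simp add: q quadratic_eval_def linear_eval_def algebra_simps power2_eq_square)
      next
        case False
        \<comment> \<open>The quadratic formula: \<open>- u\<close> and \<open>- v\<close> are the
          two real roots.\<close>
        define e where "e = sqrt (b\<^sup>2 - 4 * a * c)"
        have e: "e\<^sup>2 = b\<^sup>2 - 4 * a * c"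
          using D by (simp add: e_def)
        define u v where "u = (b + e) / (2 * a)" and "v = (b - e) / (2 * a)"
        then have uv: "b + e = 2 * a * u" "b - e = 2 * a * v"
          using False by simp_all
        then have b: "b = a * u + a * v"
          by linarith
        have "4 * a * c = 4 * a * (a * u * v)"
          using e uv by algebra
        then have c: "c = a * u * v"
          using False by simp
        show ?thesis
          by (intro exI [of _ "(a, a * u)"] exI [of _ "(1, v)"])
            (simp add: q b c quadratic_eval_def linear_eval_def algebra_simps power2_eq_square)
      qed
      with irr show False
        unfolding irreducible_quadratic_def by blast
    qed
  next
    assume D: "quadratic_discriminant q < 0"
    have False if eq: "\<forall>x y. quadratic_eval q x y = linear_eval l x y * linear_eval l' x y" for l l'
    proof -
      obtain s t s' t' where l: "l = (s, t)" "l' = (s', t')"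
        by (cases l; cases l') auto
      have "complex_of_real a = of_real (s * s')" "complex_of_real c = of_real (t * t')"
        "complex_of_real (a + b + c) = of_real ((s + t) * (s' + t'))"
        using eq [rule_format, of 1 0] eq [rule_format, of 0 1] eq [rule_format, of 1 1]
        by (simp_all add: q l quadratic_eval_def linear_eval_def)
      then have "a = s * s'" "c = t * t'" "a + b + c = (s + t) * (s' + t')"
        unfolding of_real_eq_iff by blast+
      \<comment> \<open>A product of two real linear forms has the square of their determinant as
        discriminant.\<close>
      then have "b\<^sup>2 - 4 * a * c = (s * t' - t * s')\<^sup>2"
        by algebra
      with D show False
        by (simp add: q quadratic_discriminant_def)
    qed
    moreover have "q \<noteq> 0"
      using D by auto
    ultimately show "irreducible_quadratic q"
      unfolding irreducible_quadratic_def by blast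
  qed
qed

text \<open>The definition of \<open>pi1\<close> admits any quadratic class as cofactor. The product
  lying in \<open>UTH2_Coefs\<close> forces a competing cofactor to be definite, after which
  injectivity decides.\<close>

lemma pi1_class_mult:
  assumes "L \<in> RP" "Q \<in> H2_Coefs"
  shows "pi1 (class_mult L Q) = L"
  unfolding pi1_def
proof (rule the_equality)
  have Q: "Q \<in> RP" using assms H2_subset_RP by blast
  have P: "class_mult L Q \<in> RP" by (simp add: class_mult_in_RP assms Q)
  show "L \<in> RP \<and> (\<exists>Q'\<in>RP. factorization (class_mult L Q) L Q')"
    using assms Q P by (auto simp: factorization_iff)
  fix L' assume "L' \<in> RP \<and> (\<exists>Q'\<in>RP. factorization (class_mult L Q) L' Q')"
  then obtain Q' where L': "L' \<in> RP" "Q' \<in> RP" "class_mult L Q = class_mult L' Q'"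
    using P by (auto simp: factorization_iff)
  then have "Q' \<in> H2_Coefs"
    using class_mult_in_UTH2_iff assms(1,2) Q by metis
  then show "L' = L"
    using class_mult_inject L' assms by metis
qed

lemma pi2_class_mult:
  assumes "L \<in> RP" "Q \<in> H2_Coefs"
  shows "pi2 (class_mult L Q) = Q"
  unfolding pi2_def
proof (rule the_equality)
  have Q: "Q \<in> RP" using assms H2_subset_RP by blast
  have P: "class_mult L Q \<in> RP" by (simp add: class_mult_in_RP assms Q)
  have "\<forall>q\<in>Q. irreducible_quadratic q"
    unfolding irreducible_quadratic_iff
  proof
    obtain q where q: "quadratic_discriminant q < 0" "Q = scaling_class q"
      using assms(2) unfolding H2_Coefs_eq by blast
    fix q' assume "q' \<in> Q"
    then obtain c where "c \<noteq> 0" "q' = c *\<^sub>R q"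
      unfolding q mem_scaling_class by blast
    with q show "quadratic_discriminant q' < 0"
      by (simp add: quadratic_discriminant_scaleR_neg)
  qed
  then show "Q \<in> RP \<and> (\<forall>q\<in>Q. irreducible_quadratic q) \<and> (\<exists>L'\<in>RP. factorization (class_mult L Q) L' Q)"
    using assms Q P by (auto simp: factorization_iff)
  fix Q' assume "Q' \<in> RP \<and> (\<forall>q\<in>Q'. irreducible_quadratic q) \<and> (\<exists>L'\<in>RP. factorization (class_mult L Q) L' Q')"
  then obtain L' where L': "L' \<in> RP" "Q' \<in> RP" "class_mult L Q = class_mult L' Q'"
    using P by (auto simp: factorization_iff)
  then have "Q' \<in> H2_Coefs"
    using class_mult_in_UTH2_iff assms(1,2) Q by metis
  then show "Q' = Q"
    using class_mult_inject L' assms by metis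
qed

text \<open>Continuity is tested after composition with the product of the two class maps, where
  multiplication is polynomial in the coefficients.\<close>

lemma continuous_map_class_mult:
  "continuous_map (prod_topology RP_topology RP_topology) RP_topology (\<lambda>(L, Q). class_mult L Q)"
proof (rule continuous_compose_quotient_map)
  show "quotient_map (prod_topology (top_of_set (- {0})) (top_of_set (- {0})))
      (prod_topology RP_topology RP_topology)
      (map_prod (scaling_class :: linear_form \<Rightarrow> _) (scaling_class :: quadratic_form \<Rightarrow> _))"
    by (rule quotient_map_prod_open)
      (auto simp: continuous_map_scaling_class open_map_scaling_class RP_def)
  have *: "(\<lambda>(L, Q). class_mult L Q) \<circ> map_prod scaling_class scaling_class =
      scaling_class \<circ> (\<lambda>(l, q). form_mult l q)"
    by (auto simp: class_mult_scaling_class)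
  have "continuous_on A (\<lambda>(l, q). form_mult l q)" for A
    unfolding form_mult_def split_beta by (intro continuous_intros)
  then have "continuous_map (top_of_set ((- {0}) \<times> (- {0}))) (top_of_set (- {0})) (\<lambda>(l, q). form_mult l q)"
    by (simp add: form_mult_nonzero Pi_iff split_beta)
  then show "continuous_map (prod_topology (top_of_set (- {0})) (top_of_set (- {0}))) RP_topology
      ((\<lambda>(L, Q). class_mult L Q) \<circ> map_prod scaling_class scaling_class)"
    unfolding * using continuous_map_compose [OF _ continuous_map_scaling_class]
    by (metis prod_topology_subtopology_eu)
qed

lemma homeomorphic_maps_pi:
  "homeomorphic_maps (subtopology RP_topology UTH2_Coefs)
     (prod_topology RP_topology (subtopology RP_topology H2_Coefs))
     (\<lambda>P. (pi1 P, pi2 P)) (\<lambda>(L, Q). class_mult L Q)"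
proof -
  let ?X = "prod_topology RP_topology (subtopology RP_topology H2_Coefs)"
  let ?Y = "subtopology RP_topology UTH2_Coefs"
  let ?m = "\<lambda>(L, Q). class_mult L Q"
  have X: "?X = subtopology (prod_topology RP_topology RP_topology) (RP \<times> H2_Coefs)"
    by (simp add: prod_topology_subtopology)
  have tX: "topspace ?X = RP \<times> H2_Coefs" and tY: "topspace ?Y = UTH2_Coefs"
    using H2_subset_RP UTH2_subset_RP by auto
  have "closed_map (prod_topology RP_topology RP_topology) RP_topology ?m"
    by (intro continuous_imp_closed_map continuous_map_class_mult)
      (simp_all add: compact_space_prod_topology compact_space_RP Hausdorff_space_RP)
  \<comment> \<open>\<open>RP \<times> H2_Coefs\<close> is the entire preimage of
    \<open>UTH2_Coefs\<close>; on a smaller set closedness could be lost.\<close>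
  then have closed: "closed_map ?X ?Y ?m"
    unfolding X by (rule closed_map_restriction)
      (use H2_subset_RP in \<open>auto simp: class_mult_in_UTH2_iff\<close>)
  have img: "?m ` topspace ?X = topspace ?Y"
    unfolding tX tY using H2_subset_RP by (auto simp: class_mult_in_UTH2_iff elim!: UTH2_cases)
  have cont: "continuous_map ?X ?Y ?m"
    unfolding continuous_map_in_subtopology
    using img tY by (auto simp: X continuous_map_from_subtopology continuous_map_class_mult)
  have inj: "inj_on ?m (topspace ?X)"
    unfolding tX by (auto simp: inj_on_def dest: class_mult_inject)
  have "homeomorphic_map ?X ?Y ?m"
    using cont closed img inj by (rule bijective_closed_imp_homeomorphic_map)
  then obtain k where k: "homeomorphic_maps ?X ?Y ?m k"
    using homeomorphic_map_maps by blast
  \<comment> \<open>The inverse so far is abstract; evaluating it on products shows that it is the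
    pair of projections.\<close>
  have k_eq: "k P = (pi1 P, pi2 P)" if "P \<in> topspace ?Y" for P
  proof -
    obtain L Q where LQ: "L \<in> RP" "Q \<in> H2_Coefs" "P = class_mult L Q"
      using \<open>P \<in> topspace ?Y\<close> tY by (auto elim: UTH2_cases)
    have "\<forall>x\<in>topspace ?X. k (?m x) = x"
      using k unfolding homeomorphic_maps_def by blast
    then have "k (?m (L, Q)) = (L, Q)"
      using LQ(1,2) unfolding tX by blast
    then show ?thesis
      using LQ by (simp add: pi1_class_mult pi2_class_mult)
  qed
  have "homeomorphic_maps ?Y ?X k ?m"
    using k homeomorphic_maps_sym by blast
  then show ?thesis
    by (rule homeomorphic_maps_eq) (simp_all only: k_eq)
qed

section \<open>Roots\<close>

lemma R1_scaling_class: "R1 (scaling_class (s, t)) = scaling_class (- t, s)"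
  by (auto simp: R1_def scaling_class_def image_iff)

lemma R1_in_RP: "L \<in> RP \<Longrightarrow> R1 L \<in> RP"
proof -
  assume "L \<in> RP"
  then obtain s t where "(s, t) \<noteq> 0" "L = scaling_class (s, t)"
    by (metis RP_cases surj_pair)
  then show "R1 L \<in> RP"
    by (auto simp: R1_scaling_class zero_prod_def)
qed

text \<open>\<open>R1\<close> is a quarter turn, whose square is -1 and hence trivial on classes. So
  \<open>R1\<close> is its own inverse.\<close>

lemma R1_R1: "L \<in> RP \<Longrightarrow> R1 (R1 L) = L"
proof -
  assume "L \<in> RP"
  then obtain s t where L: "L = scaling_class (s, t)"
    by (metis RP_cases surj_pair)
  then show "R1 (R1 L) = L"
    using scaling_class_scaleR [of "-1" "(s, t)"] by (simp add: R1_scaling_class)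
qed

lemma continuous_map_R1: "continuous_map RP_topology RP_topology R1"
proof (rule continuous_compose_quotient_map [OF quotient_map_scaling_class])
  have "continuous_map (top_of_set (- {0})) (top_of_set (- {0})) (\<lambda>x::real \<times> real. (- snd x, fst x))"
    by (auto simp: zero_prod_def intro!: continuous_intros)
  then have "continuous_map (top_of_set (- {0})) RP_topology (scaling_class \<circ> (\<lambda>x::real \<times> real. (- snd x, fst x)))"
    by (rule continuous_map_compose [OF _ continuous_map_scaling_class])
  moreover have "R1 \<circ> scaling_class = scaling_class \<circ> (\<lambda>x::real \<times> real. (- snd x, fst x))"
    by (auto simp: R1_scaling_class)
  ultimately show "continuous_map (top_of_set (- {0})) RP_topology (R1 \<circ> scaling_class)"
    by simp
qed

lemma homeomorphic_maps_R1: "homeomorphic_maps RP_topology RP_topology R1 R1"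
  by (simp add: homeomorphic_maps_def continuous_map_R1 R1_R1)

text \<open>The absolute value in the denominator selects the root in the upper half plane for
  either sign of \<open>a\<close>.\<close>

definition quadratic_root :: "quadratic_form \<Rightarrow> complex" where
  "quadratic_root = (\<lambda>(a, b, c). Complex (- b / (2 * a)) (sqrt (4 * a * c - b\<^sup>2) / (2 * \<bar>a\<bar>)))"

lemma quadratic_root_in_H2:
  assumes "quadratic_discriminant q < 0"
  shows "quadratic_root q \<in> H2_Roots"
proof -
  obtain a b c where q: "q = (a, b, c)"
    by (cases q) auto
  have D: "b\<^sup>2 < 4 * a * c"
    using assms by (simp add: q quadratic_discriminant_def)
  then have "a \<noteq> 0"
    using zero_le_power2 [of b] by auto
  with D show ?thesis
    by (simp add: q quadratic_root_def H2_Roots_def)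
qed

lemma quadratic_eval_factor:
  assumes "quadratic_discriminant q < 0"
  shows "quadratic_eval q x y =
    of_real (fst q) * (x - quadratic_root q * y) * (x - cnj (quadratic_root q) * y)"
proof -
  obtain a b c where q: "q = (a, b, c)"
    by (cases q) auto
  have D: "b\<^sup>2 < 4 * a * c"
    using assms by (simp add: q quadratic_discriminant_def)
  then have a: "a \<noteq> 0"
    using zero_le_power2 [of b] by auto
  define z where "z = quadratic_root q"
  define u v where "u = - b / (2 * a)" and "v = sqrt (4 * a * c - b\<^sup>2) / (2 * \<bar>a\<bar>)"
  have z: "z = Complex u v"
    by (simp add: z_def q quadratic_root_def u_def v_def)
  have "2 * a * u = - b"
    using a by (simp add: u_def)
  have "v\<^sup>2 = (4 * a * c - b\<^sup>2) / (4 * a\<^sup>2)"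
    using D by (simp add: v_def power_divide power_mult_distrib)
  then have "4 * a\<^sup>2 * v\<^sup>2 = 4 * a * c - b\<^sup>2"
    using a by simp
  then have "4 * a * (a * (u\<^sup>2 + v\<^sup>2)) = 4 * a * c"
    using \<open>2 * a * u = - b\<close> by algebra
  then have uv: "a * (u\<^sup>2 + v\<^sup>2) = c"
    using a by simp
  \<comment> \<open>Sum and product of the conjugate roots, from which Vieta's relations express
    \<open>b\<close> and \<open>c\<close>.\<close>
  have zz: "z + cnj z = of_real (2 * u)" "z * cnj z = of_real (u\<^sup>2 + v\<^sup>2)"
    by (simp_all add: z complex_eq_iff power2_eq_square)
  then have bc: "of_real b = - (of_real a * (z + cnj z))" "of_real c = of_real a * (z * cnj z)"
    unfolding zz using \<open>2 * a * u = - b\<close> uv by (metis minus_minus mult.assoc mult.commute of_real_minus of_real_mult)+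
  show ?thesis
    unfolding z_def [symmetric] unfolding q quadratic_eval_def prod.case fst_conv bc
    by (simp add: algebra_simps power2_eq_square)
qed

lemma quadratic_discriminant_neg_imp_leading_nonzero:
  assumes "quadratic_discriminant q < 0"
  shows "fst q \<noteq> 0"
  using assms by (cases q) (auto simp: quadratic_discriminant_def)

lemma quadratic_eval_scaleR: "quadratic_eval (c *\<^sub>R q) x y = of_real c * quadratic_eval q x y"
  by (cases q) (simp add: quadratic_eval_def algebra_simps)

text \<open>Vanishing at a point does not depend on the representative, and the other root lies in
  the lower half plane, so the description has exactly one solution.\<close>

lemma R2_scaling_class:
  assumes "quadratic_discriminant q < 0"
  shows "R2 (scaling_class q) = quadratic_root q"
proof -
  have z: "Im (quadratic_root q) > 0"
    using quadratic_root_in_H2 [OF assms] by (simp add: H2_Roots_def)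
  have "(\<forall>q'\<in>scaling_class q. quadratic_eval q' w 1 = 0) \<longleftrightarrow> quadratic_eval q w 1 = 0" for w
  proof
    assume "\<forall>q'\<in>scaling_class q. quadratic_eval q' w 1 = 0"
    then show "quadratic_eval q w 1 = 0"
      by (rule bspec) simp
  next
    assume "quadratic_eval q w 1 = 0"
    then show "\<forall>q'\<in>scaling_class q. quadratic_eval q' w 1 = 0"
      unfolding Ball_def mem_scaling_class by (metis mult_zero_right quadratic_eval_scaleR)
  qed
  then show ?thesis
    unfolding R2_def using z assms
    by (intro the_equality) (auto simp: quadratic_eval_factor quadratic_discriminant_neg_imp_leading_nonzero)
qed

lemma H2_cases:
  assumes "Q \<in> H2_Coefs"
  obtains q where "quadratic_discriminant q < 0" "Q = scaling_class q"
  using assms unfolding H2_Coefs_eq by blast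

lemma R2_in_H2: "Q \<in> H2_Coefs \<Longrightarrow> R2 Q \<in> H2_Roots"
  by (metis H2_cases R2_scaling_class quadratic_root_in_H2)

text \<open>The coefficients of (x - z y)(x - cnj z y), a normalized inverse of the roots
  map.\<close>

definition form_of_root :: "complex \<Rightarrow> quadratic_form" where
  "form_of_root z = (1, - 2 * Re z, (Re z)\<^sup>2 + (Im z)\<^sup>2)"

lemma quadratic_discriminant_form_of_root:
  "Im z \<noteq> 0 \<Longrightarrow> quadratic_discriminant (form_of_root z) < 0"
  by (simp add: quadratic_discriminant_def form_of_root_def power_mult_distrib)

lemma quadratic_root_form_of_root: "Im z > 0 \<Longrightarrow> quadratic_root (form_of_root z) = z"
  by (simp add: quadratic_root_def form_of_root_def power_mult_distrib complex_eq_iff real_sqrt_mult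
      flip: power_mult_distrib)

lemma form_of_root_quadratic_root:
  assumes "quadratic_discriminant q < 0"
  shows "scaling_class (form_of_root (quadratic_root q)) = scaling_class q"
proof -
  obtain a b c where q: "q = (a, b, c)"
    by (cases q) auto
  have D: "b\<^sup>2 < 4 * a * c"
    using assms by (simp add: q quadratic_discriminant_def)
  then have a: "a \<noteq> 0"
    using zero_le_power2 [of b] by auto
  have "q = a *\<^sub>R form_of_root (quadratic_root q)"
    using a D by (simp add: q form_of_root_def quadratic_root_def power_divide power_mult_distrib field_simps power2_eq_square)
  with a show ?thesis
    by (metis scaling_class_scaleR)
qed

lemma homeomorphic_maps_R2:
  "homeomorphic_maps (subtopology RP_topology H2_Coefs) (top_of_set H2_Roots) R2
     (scaling_class \<circ> form_of_root)"
proof -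
  let ?D = "{q. quadratic_discriminant q < 0}"
  have "open ?D"
    unfolding quadratic_discriminant_def split_beta by (intro open_Collect_less continuous_intros)
  have pre: "{v. v \<noteq> 0 \<and> scaling_class v \<in> H2_Coefs} = ?D"
    by (auto simp: scaling_class_in_H2)
  with \<open>open ?D\<close> have "openin RP_topology H2_Coefs"
    by (simp add: openin_RP_topology H2_subset_RP)
  \<comment> \<open>A quotient map restricts to a quotient map over an open set, here
    \<open>H2_Coefs\<close>; this allows \<open>R2\<close> to be tested on the explicit root
    formula.\<close>
  then have quo: "quotient_map (subtopology (top_of_set (- {0})) ?D) (subtopology RP_topology H2_Coefs) scaling_class"
    using pre by (intro quotient_map_restriction [OF quotient_map_scaling_class]) auto
  have tD: "subtopology (top_of_set (- {0})) ?D = top_of_set ?D"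
  proof -
    have "- {0} \<inter> ?D = ?D"
      by auto
    then show ?thesis
      by (simp add: subtopology_subtopology)
  qed
  have "continuous_on ?D quadratic_root"
    unfolding quadratic_root_def split_beta Complex_eq
    by (intro continuous_intros) (auto dest: quadratic_discriminant_neg_imp_leading_nonzero)
  then have "continuous_map (top_of_set ?D) (top_of_set H2_Roots) quadratic_root"
    by (auto intro: quadratic_root_in_H2)
  then have "continuous_map (top_of_set ?D) (top_of_set H2_Roots) (R2 \<circ> scaling_class)"
    by (rule continuous_map_eq) (simp add: R2_scaling_class)
  then have "continuous_map (subtopology RP_topology H2_Coefs) (top_of_set H2_Roots) R2"
    using continuous_compose_quotient_map quo unfolding tD by blast
  moreover have "continuous_map (top_of_set H2_Roots) (subtopology RP_topology H2_Coefs) (scaling_class \<circ> form_of_root)"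
  proof -
    have "form_of_root z \<noteq> 0" for z
      by (simp add: form_of_root_def zero_prod_def)
    moreover have "continuous_on H2_Roots form_of_root"
      unfolding form_of_root_def by (intro continuous_intros)
    ultimately have "continuous_map (top_of_set H2_Roots) (top_of_set (- {0})) form_of_root"
      by auto
    then show ?thesis
      unfolding continuous_map_in_subtopology
      by (auto simp: continuous_map_compose [OF _ continuous_map_scaling_class] scaling_class_in_H2
          H2_Roots_def quadratic_discriminant_form_of_root)
  qed
  moreover have "(scaling_class \<circ> form_of_root) (R2 Q) = Q" if "Q \<in> H2_Coefs" for Q
    using that by (auto elim!: H2_cases simp: R2_scaling_class form_of_root_quadratic_root)
  moreover have "R2 ((scaling_class \<circ> form_of_root) z) = z" if "z \<in> H2_Roots" for z
    using that by (simp add: H2_Roots_def R2_scaling_class quadratic_discriminant_form_of_root quadratic_root_form_of_root)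
  ultimately show ?thesis
    by (auto simp: homeomorphic_maps_def)
qed

section \<open>Points of the complex projective line and roots of a product\<close>

lemma CP1_class_eq_iff:
  assumes "(z, w) \<noteq> (0, 0)" "(z', w') \<noteq> (0, 0)"
  shows "CP1_class (z, w) = CP1_class (z', w') \<longleftrightarrow> z * w' = z' * w"
proof
  assume "CP1_class (z, w) = CP1_class (z', w')"
  moreover have "(z, w) \<in> CP1_class (z, w)"
    unfolding CP1_class_def by (auto intro!: exI [of _ 1])
  ultimately show "z * w' = z' * w"
    by (auto simp: CP1_class_def)
next
  assume eq: "z * w' = z' * w"
  obtain k where k: "k \<noteq> 0" "z' = k * z" "w' = k * w"
  proof (cases "z = 0")
    case True
    with eq assms show ?thesis
      by (intro that [of "w' / w"]) auto
  next
    case False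
    with eq assms show ?thesis
      by (intro that [of "z' / z"]) (auto simp: field_simps)
  qed
  show "CP1_class (z, w) = CP1_class (z', w')"
  proof (intro equalityI subsetI)
    fix p assume "p \<in> CP1_class (z, w)"
    then obtain c where "c \<noteq> 0" "p = (c * z, c * w)"
      by (auto simp: CP1_class_def)
    with k show "p \<in> CP1_class (z', w')"
      by (auto simp: CP1_class_def intro!: exI [of _ "c / k"])
  next
    fix p assume "p \<in> CP1_class (z', w')"
    then obtain c where "c \<noteq> 0" "p = (c * z', c * w')"
      by (auto simp: CP1_class_def)
    with k show "p \<in> CP1_class (z, w)"
      by (auto simp: CP1_class_def intro!: exI [of _ "c * k"])
  qed
qed

lemma real_point_scaling_class: "real_point (scaling_class (p, q)) = CP1_class (of_real p, of_real q)"
proof (intro equalityI subsetI)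
  fix x assume "x \<in> real_point (scaling_class (p, q))"
  then obtain c d where "c \<noteq> 0" "d \<noteq> 0" "x = (c * of_real (d * p), c * of_real (d * q))"
    by (auto simp: real_point_def scaling_class_def)
  then show "x \<in> CP1_class (of_real p, of_real q)"
    by (auto simp: CP1_class_def intro!: exI [of _ "c * of_real d"])
next
  fix x assume "x \<in> CP1_class (complex_of_real p, complex_of_real q)"
  then obtain c where "c \<noteq> 0" "x = (c * of_real p, c * of_real q)"
    by (auto simp: CP1_class_def)
  moreover have "(p, q) \<in> scaling_class (p, q)"
    by simp
  ultimately show "x \<in> real_point (scaling_class (p, q))"
    unfolding real_point_def by blast
qed

lemma real_point_inject:
  assumes "r \<in> RP" "r' \<in> RP"
  shows "real_point r = real_point r' \<longleftrightarrow> r = r'"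
proof
  obtain p q where r: "(p, q) \<noteq> 0" "r = scaling_class (p, q)"
    using assms by (metis RP_cases surj_pair)
  obtain p' q' where r': "(p', q') \<noteq> 0" "r' = scaling_class (p', q')"
    using assms by (metis RP_cases surj_pair)
  assume "real_point r = real_point r'"
  then have "complex_of_real p * of_real q' = of_real p' * of_real q"
    using r r' by (subst (asm) (1 2) r r')
      (auto simp: r r' real_point_scaling_class CP1_class_eq_iff zero_prod_def)
  then have eq: "p * q' = p' * q"
    by (simp flip: of_real_mult)
  show "r = r'"
  proof (cases "p = 0")
    case True
    with eq r r' show ?thesis
      by (auto simp: scaling_class_eq_iff zero_prod_def intro!: exI [of _ "q' / q"])
  next
    case False
    with eq r r' show ?thesis
      by (auto simp: scaling_class_eq_iff zero_prod_def field_simps intro!: exI [of _ "p' / p"])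
  qed
qed simp

lemma affine_point_inject: "affine_point z = affine_point w \<longleftrightarrow> z = w"
  by (simp add: affine_point_def CP1_class_eq_iff)

text \<open>The ratio of the coordinates of a real point is real or infinite. This separates the
  conjugate pair from the real root when the leaves are computed.\<close>

lemma affine_point_neq_real_point:
  assumes "r \<in> RP" "Im z \<noteq> 0"
  shows "affine_point z \<noteq> real_point r"
proof
  obtain p q where r: "(p, q) \<noteq> 0" "r = scaling_class (p, q)"
    using assms by (metis RP_cases surj_pair)
  assume "affine_point z = real_point r"
  then have "z * of_real q = of_real p"
    using r by (simp add: affine_point_def real_point_scaling_class CP1_class_eq_iff zero_prod_def)
  then have "Im (z * of_real q) = 0" "Re (z * of_real q) = p"
    by simp_all
  with assms(2) r(1) show False
    by (auto simp: zero_prod_def)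
qed

lemma cubic_eval_scaleR: "cubic_eval (c *\<^sub>R f) x y = of_real c * cubic_eval f x y"
  by (cases f) (simp add: cubic_eval_def algebra_simps)

text \<open>A product vanishes where one factor does. Over the complex numbers the quadratic splits,
  and each of the three linear factors vanishes at exactly one projective point.\<close>

lemma R3_class_mult:
  assumes "L \<in> RP" "Q \<in> H2_Coefs"
  shows "R3 (class_mult L Q) = unordered_roots (R1 L, R2 Q)"
proof -
  obtain s t where L: "(s, t) \<noteq> 0" "L = scaling_class (s, t)"
    using assms by (metis RP_cases surj_pair)
  obtain q where q: "quadratic_discriminant q < 0" "Q = scaling_class q"
    using assms by (auto elim: H2_cases)
  define \<zeta> where "\<zeta> = quadratic_root q"
  have "cubic_eval f z w = 0 \<longleftrightarrow> cubic_eval (form_mult (s, t) q) z w = 0"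
    if "f \<in> class_mult L Q" for f z w
    using that unfolding L q class_mult_scaling_class mem_scaling_class
    by (auto simp: cubic_eval_scaleR)
  moreover have "form_mult (s, t) q \<in> class_mult L Q"
    unfolding L q class_mult_scaling_class mem_scaling_class by (intro exI [of _ 1]) simp
  ultimately have "(\<forall>f\<in>class_mult L Q. cubic_eval f z w = 0) \<longleftrightarrow>
      linear_eval (s, t) z w = 0 \<or> quadratic_eval q z w = 0" for z w
    by (metis cubic_eval_form_mult mult_eq_0_iff)
  moreover have "linear_eval (s, t) z w = 0 \<longleftrightarrow> CP1_class (z, w) = real_point (R1 L)"
    if "(z, w) \<noteq> (0, 0)" for z w
  proof -
    have "CP1_class (z, w) = real_point (R1 L) \<longleftrightarrow> z * of_real s = of_real (- t) * w"
      using that L(1) unfolding L(2) R1_scaling_class real_point_scaling_class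
      by (intro CP1_class_eq_iff) (auto simp: zero_prod_def)
    then show ?thesis
      by (auto simp: linear_eval_def mult.commute add_eq_0_iff)
  qed
  moreover have "quadratic_eval q z w = 0 \<longleftrightarrow>
      CP1_class (z, w) = affine_point \<zeta> \<or> CP1_class (z, w) = affine_point (cnj \<zeta>)"
    if "(z, w) \<noteq> (0, 0)" for z w
    using q that unfolding affine_point_def
    by (simp add: CP1_class_eq_iff quadratic_eval_factor quadratic_discriminant_neg_imp_leading_nonzero \<zeta>_def)
  ultimately have "R3 (class_mult L Q) = {CP1_class (z, w) | z w. (z, w) \<noteq> (0, 0) \<and>
      CP1_class (z, w) \<in> {real_point (R1 L), affine_point \<zeta>, affine_point (cnj \<zeta>)}}"
    unfolding R3_def by (intro Collect_cong) (metis insert_iff empty_iff)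
  \<comment> \<open>It remains to see that each of the three points has nonzero homogeneous
    coordinates.\<close>
  also have "\<dots> = {real_point (R1 L), affine_point \<zeta>, affine_point (cnj \<zeta>)}"
  proof -
    have "real_point (R1 L) = CP1_class (of_real (- t), of_real s)" "(complex_of_real (- t), complex_of_real s) \<noteq> (0, 0)"
      using L(1) unfolding L(2) R1_scaling_class real_point_scaling_class by (auto simp: zero_prod_def)
    moreover have "affine_point z = CP1_class (z, 1)" "(z, 1) \<noteq> (0, 0::complex)" for z
      by (simp_all add: affine_point_def)
    ultimately show ?thesis
      by blast
  qed
  finally show ?thesis
    by (simp add: unordered_roots_def q R2_scaling_class \<zeta>_def)
qed

section \<open>The unit tangent bundle\<close>

text \<open>For e = p - q z the quotient of e by its conjugate is unchanged by real scaling of (p,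
  q). The ideal point infinity, (p, q) = (1, 0), gives the vertical vector i Im z.\<close>

definition direction :: "complex \<Rightarrow> real \<times> real \<Rightarrow> complex" where
  "direction z = (\<lambda>(p, q). \<i> * of_real (Im z) * ((of_real p - of_real q * z) / cnj (of_real p - of_real q * z)))"

lemma linear_at_nonreal_nonzero:
  assumes "Im z > 0" "(p, q) \<noteq> 0"
  shows "of_real p - of_real q * z \<noteq> 0"
proof
  assume "of_real p - of_real q * z = 0"
  then have "Re (of_real p - of_real q * z) = 0" "Im (of_real p - of_real q * z) = 0"
    by simp_all
  with assms show False
    by (auto simp: zero_prod_def)
qed

lemma direction_scaleR:
  assumes "c \<noteq> 0"
  shows "direction z (c *\<^sub>R w) = direction z w"
proof -
  obtain p q where w: "w = (p, q)"
    by fastforce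
  have "of_real (c * p) - of_real (c * q) * z = of_real c * (of_real p - of_real q * z)"
    by (simp add: algebra_simps)
  with assms show ?thesis
    unfolding direction_def w scaleR_Pair real_scaleR_def prod.case by simp
qed

lemma direction_in_sphere:
  assumes "Im z > 0" "w \<noteq> 0"
  shows "direction z w \<in> sphere 0 (Im z)"
proof -
  obtain p q where w: "w = (p, q)"
    by fastforce
  show ?thesis
    using assms linear_at_nonreal_nonzero [of z p q] unfolding direction_def w prod.case
    by (simp add: norm_mult norm_divide del: complex_cnj_diff complex_cnj_mult)
qed

lemma direction_inject:
  assumes "Im z > 0" "w \<noteq> 0" "w' \<noteq> 0" "direction z w = direction z w'"
  shows "scaling_class w = scaling_class w'"
proof -
  obtain p q p' q' where w: "w = (p, q)" "w' = (p', q')"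
    by fastforce
  define e where "e = of_real p - of_real q * z"
  define e' where "e' = of_real p' - of_real q' * z"
  have ne: "e \<noteq> 0" "e' \<noteq> 0"
    using assms linear_at_nonreal_nonzero by (auto simp: e_def e'_def w)
  have "\<i> * of_real (Im z) * (e / cnj e) = \<i> * of_real (Im z) * (e' / cnj e')"
    using assms(4) unfolding direction_def w prod.case e_def e'_def .
  moreover have "\<i> * complex_of_real (Im z) \<noteq> 0"
    using assms(1) by simp
  ultimately have "e / cnj e = e' / cnj e'"
    by (metis mult_left_cancel)
  then have "e * cnj e' = e' * cnj e"
    using ne by (simp add: field_simps)
  then have "Im (e * cnj e') = Im (e' * cnj e)"
    by simp
  \<comment> \<open>The preceding equation says that \<open>e * cnj e'\<close> is real; its
    imaginary part is \<open>Im z\<close> times the determinant of the two vectors.\<close>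
  then have "Im z * (p * q' - p' * q) = 0"
    by (simp add: e_def e'_def algebra_simps)
  with assms(1) have eq: "p * q' = p' * q"
    by simp
  show ?thesis
  proof (cases "p = 0")
    case True
    with eq assms show ?thesis
      by (auto simp: w scaling_class_eq_iff zero_prod_def intro!: exI [of _ "q' / q"])
  next
    case False
    with eq assms show ?thesis
      by (auto simp: w scaling_class_eq_iff zero_prod_def field_simps intro!: exI [of _ "p' / p"])
  qed
qed

text \<open>The ideal point is found by writing the unit complex number v / (i Im z) as e / cnj e
  with e a square root of it.\<close>

lemma direction_surj:
  assumes "Im z > 0" "v \<in> sphere 0 (Im z)"
  obtains w where "w \<noteq> 0" "direction z w = v"
proof -
  define u where "u = v / (\<i> * of_real (Im z))"
  have "cmod u = 1"
    using assms by (simp add: u_def norm_divide norm_mult)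
  define e where "e = csqrt u"
  have e: "e\<^sup>2 = u"
    by (simp add: e_def)
  then have ce: "cmod e = 1"
    using \<open>cmod u = 1\<close> by (simp add: e_def norm_csqrt)
  then have "e * cnj e = 1"
    by (simp add: complex_norm_square [symmetric])
  moreover have "e \<noteq> 0"
    using ce by auto
  ultimately have "e / cnj e = u"
    using e by (simp add: field_simps power2_eq_square) (metis mult.assoc mult.commute mult_1)
  \<comment> \<open>As Im z is nonzero, 1 and z form a real basis of the complex plane; these are
    the coordinates of \<open>e\<close> in p - q z.\<close>
  define q p where "q = - Im e / Im z" and "p = Re e + q * Re z"
  have "of_real p - of_real q * z = e"
    using assms(1) by (simp add: complex_eq_iff p_def q_def)
  show ?thesis
  proof (rule that)
    show "(p, q) \<noteq> 0"
      using \<open>of_real p - of_real q * z = e\<close> \<open>e \<noteq> 0\<close> by (auto simp: zero_prod_def)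
    have "direction z (p, q) = \<i> * of_real (Im z) * (e / cnj e)"
      unfolding direction_def prod.case \<open>of_real p - of_real q * z = e\<close> ..
    also have "\<dots> = v"
      unfolding \<open>e / cnj e = u\<close> using assms(1) by (simp add: u_def)
    finally show "direction z (p, q) = v" .
  qed
qed

text \<open>By the chain rule the velocity is i times the derivative 1 / w^2 of the isometry at i,
  where w = c i + d; the direction formula reduces to the same number.\<close>

lemma geodesic_initial_velocity:
  assumes det: "a * d - b * c = 1"
  shows "Im (geodesic a b c d 0) > 0"
    "(geodesic a b c d has_vector_derivative direction (geodesic a b c d 0) (a, c)) (at 0)"
proof -
  define w where "w = of_real c * \<i> + of_real d"
  define n where "n = of_real a * \<i> + of_real b"
  define z where "z = geodesic a b c d 0"
  have "w \<noteq> 0"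
  proof
    assume "w = 0"
    then have "Re w = 0" "Im w = 0"
      by simp_all
    with det show False
      by (simp add: w_def)
  qed
  have z: "z = n / w"
    by (simp add: z_def geodesic_def n_def w_def)
  have detc: "complex_of_real a * of_real d - of_real b * of_real c = 1"
    using det by (metis of_real_1 of_real_diff of_real_mult)
  have e: "of_real a - of_real c * z = 1 / w"
    using \<open>w \<noteq> 0\<close> detc by (simp add: z field_simps n_def w_def)
  have "of_real (Im z) = 1 / (w * cnj w)"
  proof -
    \<comment> \<open>The imaginary part of \<open>n * cnj w\<close> is the determinant ad -
      bc.\<close>
    have "n * cnj w - cnj n * w = 2 * \<i>"
      using det by (simp add: n_def w_def complex_eq_iff algebra_simps)
    then have "z - cnj z = 2 * \<i> / (w * cnj w)"
      using \<open>w \<noteq> 0\<close> by (simp add: z field_simps)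
    moreover have "z - cnj z = 2 * \<i> * of_real (Im z)"
      by (simp add: complex_eq_iff)
    ultimately have "2 * \<i> * of_real (Im z) = 2 * \<i> * (1 / (w * cnj w))"
      by (simp only: times_divide_eq_right mult_1_right)
    then show ?thesis
      unfolding mult_cancel_left by simp
  qed
  moreover have "w * cnj w = of_real ((cmod w)\<^sup>2)"
    by (metis complex_norm_square)
  ultimately have "of_real (Im z) = complex_of_real (1 / (cmod w)\<^sup>2)"
    by simp
  then have "Im z = 1 / (cmod w)\<^sup>2"
    by (metis of_real_eq_iff)
  with \<open>w \<noteq> 0\<close> show "Im (geodesic a b c d 0) > 0"
    by (simp flip: z_def)
  have "direction z (a, c) = \<i> * (1 / (w * cnj w)) * ((1 / w) / cnj (1 / w))"
    unfolding direction_def prod.case e \<open>of_real (Im z) = 1 / (w * cnj w)\<close> ..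
  also have "\<dots> = \<i> / w\<^sup>2"
    using \<open>w \<noteq> 0\<close> by (simp add: power2_eq_square)
  finally have dir: "direction z (a, c) = \<i> / w\<^sup>2" .
  have E: "((\<lambda>t. \<i> * complex_of_real (exp t)) has_vector_derivative \<i>) (at 0)"
    by (auto intro!: derivative_eq_intros)
  have D: "((\<lambda>y. (of_real a * y + of_real b) / (of_real c * y + of_real d)) has_field_derivative 1 / w\<^sup>2)
      (at (\<i> * complex_of_real (exp 0)))"
  proof -
    have "((\<lambda>y. (of_real a * y + of_real b) / (of_real c * y + of_real d)) has_field_derivative
        (of_real a * w - n * of_real c) / (w * w)) (at \<i>)"
      using \<open>w \<noteq> 0\<close> unfolding w_def n_def by (auto intro!: derivative_eq_intros)
    moreover have "of_real a * w - n * of_real c = 1"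
      using detc by (simp add: w_def n_def algebra_simps)
    ultimately show ?thesis
      by (simp add: power2_eq_square)
  qed
  have "((\<lambda>y. (of_real a * y + of_real b) / (of_real c * y + of_real d)) \<circ> (\<lambda>t. \<i> * complex_of_real (exp t))
      has_vector_derivative \<i> * (1 / w\<^sup>2)) (at 0)"
    by (rule field_vector_diff_chain_at [OF E D])
  moreover have "(\<lambda>y. (of_real a * y + of_real b) / (of_real c * y + of_real d)) \<circ> (\<lambda>t. \<i> * complex_of_real (exp t)) =
      geodesic a b c d"
    by (auto simp: geodesic_def)
  ultimately show "(geodesic a b c d has_vector_derivative direction (geodesic a b c d 0) (a, c)) (at 0)"
    by (simp add: dir flip: z_def)
qed

text \<open>Uniqueness of derivatives gives one direction. For the other, a real matrix of
  determinant 1 is built whose first column is proportional to \<open>w\<close> and whose isometry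
  takes i to \<open>z\<close>.\<close>

lemma points_to_iff:
  assumes z: "Im z > 0" and w: "w \<noteq> 0"
  shows "points_to z v (scaling_class w) \<longleftrightarrow> v = direction z w"
proof
  assume "points_to z v (scaling_class w)"
  then obtain a b c d where det: "a * d - b * c = 1" and g: "geodesic a b c d 0 = z"
    and v: "(geodesic a b c d has_vector_derivative v) (at 0)"
    and w': "scaling_class w = scaling_class (a, c)"
    by (auto simp: points_to_def)
  have "v = direction z (a, c)"
    using vector_derivative_unique_at [OF v geodesic_initial_velocity(2) [OF det]] g by simp
  with w' show "v = direction z w"
    by (metis direction_scaleR scaling_class_eq_iff)
next
  obtain p q where w_eq: "w = (p, q)"
    by fastforce
  define e where "e = of_real p - of_real q * z"
  have "e \<noteq> 0"
    using linear_at_nonreal_nonzero z w by (simp add: e_def w_eq)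
  \<comment> \<open>The scale of the first column is forced up to sign: determinant 1 requires |a -
    c z|^2 = Im z.\<close>
  define k where "k = sqrt (Im z) / cmod e"
  have "k \<noteq> 0"
    using z \<open>e \<noteq> 0\<close> by (simp add: k_def)
  define a c where "a = k * p" and "c = k * q"
  \<comment> \<open>\<open>d\<close> and then \<open>b\<close> solve a i + b = z (c i + d), split
    into imaginary and real parts.\<close>
  define d where "d = (a - c * Re z) / Im z"
  define b where "b = Re z * d - Im z * c"
  have "k\<^sup>2 * (cmod e)\<^sup>2 = Im z"
    using z \<open>e \<noteq> 0\<close> by (simp add: k_def power_divide)
  moreover have "(cmod e)\<^sup>2 = (p - q * Re z)\<^sup>2 + (q * Im z)\<^sup>2"
    by (simp add: cmod_power2 e_def)
  moreover have "(a - c * Re z)\<^sup>2 + (c * Im z)\<^sup>2 = k\<^sup>2 * ((p - q * Re z)\<^sup>2 + (q * Im z)\<^sup>2)"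
    by (simp add: a_def c_def power2_eq_square algebra_simps)
  ultimately have "(a - c * Re z)\<^sup>2 + (c * Im z)\<^sup>2 = Im z"
    by simp
  moreover have "Im z * d = a - c * Re z"
    using z by (simp add: d_def)
  moreover have "Im z * (a * d - b * c) = a * (Im z * d) - c * Re z * (Im z * d) + (c * Im z)\<^sup>2"
    by (simp add: b_def algebra_simps power2_eq_square)
  moreover have "a * (a - c * Re z) - c * Re z * (a - c * Re z) = (a - c * Re z)\<^sup>2"
    by (simp add: algebra_simps power2_eq_square)
  ultimately have "Im z * (a * d - b * c) = Im z * 1"
    by simp
  then have det: "a * d - b * c = 1"
    using z by simp
  have "of_real c * \<i> + of_real d \<noteq> 0"
  proof
    assume "of_real c * \<i> + of_real d = 0"
    then have "Re (of_real c * \<i> + of_real d) = 0" "Im (of_real c * \<i> + of_real d) = 0"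
      by simp_all
    with det show False
      by simp
  qed
  moreover have "of_real a * \<i> + of_real b = z * (of_real c * \<i> + of_real d)"
    using \<open>Im z * d = a - c * Re z\<close> by (simp add: complex_eq_iff b_def algebra_simps)
  ultimately have g: "geodesic a b c d 0 = z"
    by (simp add: geodesic_def field_simps)
  have ac: "(a, c) = k *\<^sub>R w"
    by (simp add: a_def c_def w_eq)
  assume "v = direction z w"
  then have "(geodesic a b c d has_vector_derivative v) (at 0)"
    using geodesic_initial_velocity(2) [OF det] direction_scaleR [OF \<open>k \<noteq> 0\<close>] by (simp add: g ac)
  moreover have "scaling_class w = scaling_class (a, c)"
    by (simp add: ac scaling_class_scaleR \<open>k \<noteq> 0\<close>)
  ultimately show "points_to z v (scaling_class w)"
    using det g unfolding points_to_def by blast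
qed

section \<open>The unit vectors at a point as a copy of the ideal boundary\<close>

definition ideal_direction :: "complex \<Rightarrow> (real \<times> real) set \<Rightarrow> complex" where
  "ideal_direction z r = (THE v. points_to z v r)"

lemma ideal_direction_scaling_class:
  "Im z > 0 \<Longrightarrow> w \<noteq> 0 \<Longrightarrow> ideal_direction z (scaling_class w) = direction z w"
  by (simp add: ideal_direction_def points_to_iff)

lemma points_to_ideal_direction:
  "Im z > 0 \<Longrightarrow> r \<in> RP \<Longrightarrow> points_to z (ideal_direction z r) r"
  by (auto elim!: RP_cases simp: ideal_direction_scaling_class points_to_iff)

lemma bij_betw_ideal_direction:
  assumes "Im z > 0"
  shows "bij_betw (ideal_direction z) RP (sphere 0 (Im z))"
  unfolding bij_betw_def
proof
  show "inj_on (ideal_direction z) RP"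
  proof (rule inj_onI)
    fix r r' :: "(real \<times> real) set"
    assume r: "r \<in> RP" "r' \<in> RP" "ideal_direction z r = ideal_direction z r'"
    obtain w w' where w: "w \<noteq> 0" "r = scaling_class w" "w' \<noteq> 0" "r' = scaling_class w'"
      using r(1,2) by (metis RP_cases)
    then have "direction z w = direction z w'"
      using r(3) assms by (simp add: ideal_direction_scaling_class)
    then show "r = r'"
      unfolding w by (rule direction_inject [OF assms w(1,3)])
  qed
  show "ideal_direction z ` RP = sphere 0 (Im z)"
  proof (intro equalityI subsetI)
    fix v assume "v \<in> ideal_direction z ` RP"
    then obtain r where r: "r \<in> RP" "v = ideal_direction z r"
      by blast
    from r(1) obtain w where w: "w \<noteq> 0" "r = scaling_class w"
      by (rule RP_cases)
    show "v \<in> sphere 0 (Im z)"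
      unfolding r(2) w(2) ideal_direction_scaling_class [OF assms w(1)]
      using assms w(1) by (rule direction_in_sphere)
  next
    fix v :: complex assume "v \<in> sphere 0 (Im z)"
    with assms obtain w where w: "w \<noteq> 0" "direction z w = v"
      by (rule direction_surj)
    show "v \<in> ideal_direction z ` RP"
    proof (rule image_eqI)
      show "v = ideal_direction z (scaling_class w)"
        using w assms by (simp add: ideal_direction_scaling_class)
      show "scaling_class w \<in> RP"
        using w by simp
    qed
  qed
qed

text \<open>Joint continuity in the ideal point and the base point, read off on representatives,
  where the denominator of \<open>direction\<close> has no zero.\<close>

lemma continuous_map_ideal_direction:
  "continuous_map (prod_topology RP_topology (top_of_set H2_Roots)) euclidean
     (\<lambda>(r, z). ideal_direction z r)"
proof (rule continuous_compose_quotient_map)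
  show "quotient_map (prod_topology (top_of_set (- {0})) (top_of_set H2_Roots))
      (prod_topology RP_topology (top_of_set H2_Roots))
      (map_prod (scaling_class :: real \<times> real \<Rightarrow> _) id)"
    by (rule quotient_map_prod_open)
      (use open_map_scaling_class in \<open>auto simp: continuous_map_scaling_class RP_def open_map_def\<close>)
  have "continuous_on ((- {0}) \<times> H2_Roots) (\<lambda>(w, z). direction z w)"
    unfolding direction_def split_beta
  proof (intro continuous_intros ballI)
    fix x :: "(real \<times> real) \<times> complex"
    assume "x \<in> (- {0}) \<times> H2_Roots"
    then show "cnj (of_real (fst (fst x)) - of_real (snd (fst x)) * snd x) \<noteq> 0"
      unfolding complex_cnj_zero_iff by (intro linear_at_nonreal_nonzero) (auto simp: H2_Roots_def)
  qed
  then have "continuous_map (top_of_set ((- {0}) \<times> H2_Roots)) euclidean (\<lambda>(w, z). direction z w)"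
    by simp
  then have "continuous_map (top_of_set ((- {0}) \<times> H2_Roots)) euclidean
      ((\<lambda>(r, z). ideal_direction z r) \<circ> map_prod scaling_class id)"
  proof (rule continuous_map_eq)
    fix x :: "(real \<times> real) \<times> complex"
    assume x: "x \<in> topspace (top_of_set ((- {0}) \<times> H2_Roots))"
    obtain w z where wz: "x = (w, z)"
      by fastforce
    with x have "w \<noteq> 0" "Im z > 0"
      by (auto simp: H2_Roots_def)
    then show "(case x of (w, z) \<Rightarrow> direction z w) = ((\<lambda>(r, z). ideal_direction z r) \<circ> map_prod scaling_class id) x"
      by (simp add: wz ideal_direction_scaling_class)
  qed
  then show "continuous_map (prod_topology (top_of_set (- {0})) (top_of_set H2_Roots)) euclidean
      ((\<lambda>(r, z). ideal_direction z r) \<circ> map_prod scaling_class id)"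
    by (metis prod_topology_subtopology_eu)
qed

text \<open>Projection along a compact factor is closed, and each fibre is a copy of that
  factor.\<close>

lemma proper_map_snd_compact:
  assumes "compact_space X"
  shows "proper_map (prod_topology X Y) Y snd"
  unfolding proper_map_def
proof (intro conjI ballI)
  show "closed_map (prod_topology X Y) Y snd"
    using assms by (rule closed_map_snd)
  fix y assume "y \<in> topspace Y"
  then have "{p \<in> topspace (prod_topology X Y). snd p = y} = topspace X \<times> {y}"
    by auto
  moreover have "compactin (prod_topology X Y) (topspace X \<times> {y})"
    using assms \<open>y \<in> topspace Y\<close> by (simp add: compactin_Times compact_space_def)
  ultimately show "compactin (prod_topology X Y) {p \<in> topspace (prod_topology X Y). snd p = y}"
    by simp
qed

text \<open>The projection to the base point is proper because the fibres are compact, so a continuous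
  bijection over the base is closed.\<close>

lemma homeomorphic_map_unit_tangent_bundle:
  "homeomorphic_map (prod_topology RP_topology (top_of_set H2_Roots)) (top_of_set unit_tangent_bundle)
     (\<lambda>(r, z). (z, ideal_direction z r))"
proof (rule bijective_closed_imp_homeomorphic_map)
  let ?X = "prod_topology (RP_topology :: (real \<times> real) set topology) (top_of_set H2_Roots)"
  let ?f = "\<lambda>(r, z). (z, ideal_direction z r)"
  have bij: "ideal_direction z ` RP = sphere 0 (Im z)" "inj_on (ideal_direction z) RP" if "z \<in> H2_Roots" for z
    using bij_betw_ideal_direction [of z] that by (auto simp: H2_Roots_def bij_betw_def)
  have UT: "(z, v) \<in> unit_tangent_bundle \<longleftrightarrow> z \<in> H2_Roots \<and> v \<in> sphere 0 (Im z)" for z v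
    by (auto simp: unit_tangent_bundle_def H2_Roots_def divide_eq_1_iff)
  show img: "?f ` topspace ?X = topspace (top_of_set unit_tangent_bundle)"
  proof (intro equalityI subsetI)
    fix x assume "x \<in> ?f ` topspace ?X"
    then obtain r z where "r \<in> RP" "z \<in> H2_Roots" "x = (z, ideal_direction z r)"
      by auto
    moreover from this have "ideal_direction z r \<in> sphere 0 (Im z)"
      using bij(1) by blast
    ultimately show "x \<in> topspace (top_of_set unit_tangent_bundle)"
      by (simp add: UT)
  next
    fix x assume x: "x \<in> topspace (top_of_set unit_tangent_bundle)"
    obtain z v where zv: "x = (z, v)"
      by fastforce
    then have z: "z \<in> H2_Roots" and "v \<in> sphere 0 (Im z)"
      using x by (simp_all add: UT)
    then obtain r where "r \<in> RP" "v = ideal_direction z r"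
      unfolding bij(1) [OF z, symmetric] by blast
    with z show "x \<in> ?f ` topspace ?X"
      by (intro image_eqI [of _ _ "(r, z)"]) (simp_all add: zv)
  qed
  show "inj_on ?f (topspace ?X)"
    using bij(2) by (auto simp: inj_on_def)
  have "continuous_map ?X euclidean (snd :: _ \<Rightarrow> complex)"
    by (rule continuous_map_into_fulltopology [OF continuous_map_snd])
  from continuous_map_pairedI [OF this continuous_map_ideal_direction]
  have "continuous_map ?X euclidean ?f"
    by (simp add: case_prod_unfold)
  then show cont: "continuous_map ?X (top_of_set unit_tangent_bundle) ?f"
    using img by (auto simp: continuous_map_in_subtopology)
  \<comment> \<open>Followed by the base point projection, the map becomes the proper projection
    \<open>snd\<close>; with a Hausdorff target in between, properness passes to the map
    itself.\<close>
  have "proper_map ?X (top_of_set unit_tangent_bundle) ?f"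
  proof (rule proper_map_from_composition_right [OF _ _ cont])
    show "Hausdorff_space (top_of_set unit_tangent_bundle)"
      by (simp add: Hausdorff_space_subtopology)
    have "fst \<circ> ?f = snd"
      by auto
    then show "proper_map ?X (top_of_set H2_Roots) (fst \<circ> ?f)"
      by (simp add: proper_map_snd_compact compact_space_RP)
    show "continuous_map (top_of_set unit_tangent_bundle) (top_of_set H2_Roots) fst"
      by (auto simp: unit_tangent_bundle_def intro!: continuous_intros)
  qed
  then show "closed_map ?X (top_of_set unit_tangent_bundle) ?f"
    by (rule proper_imp_closed_map)
qed

text \<open>At the point i the vectors of hyperbolic length 1 form the Euclidean unit circle, so the
  ideal direction from i is a continuous bijection from a compact space onto it.\<close>

lemma RP1_homeomorphic_circle:
  "(RP_topology :: (real \<times> real) set topology) homeomorphic_space top_of_set (sphere (0::complex) 1)"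
proof -
  have bij: "bij_betw (ideal_direction \<i>) RP (sphere 0 1)"
    using bij_betw_ideal_direction [of \<i>] by simp
  have "continuous_map RP_topology (prod_topology RP_topology (top_of_set H2_Roots)) (\<lambda>r::(real \<times> real) set. (r, \<i>))"
    by (simp add: continuous_map_paired H2_Roots_def)
  from continuous_map_compose [OF this continuous_map_ideal_direction]
  have "continuous_map RP_topology euclidean (ideal_direction \<i>)"
    by (simp add: o_def)
  then have "continuous_map RP_topology (top_of_set (sphere 0 1)) (ideal_direction \<i>)"
    using bij by (auto simp: continuous_map_in_subtopology bij_betw_def)
  then have "homeomorphic_map RP_topology (top_of_set (sphere 0 1)) (ideal_direction \<i>)"
    using bij by (intro bijective_closed_imp_homeomorphic_map continuous_imp_closed_map)
      (auto simp: bij_betw_def compact_space_RP Hausdorff_space_subtopology)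
  then show ?thesis
    using homeomorphic_map_imp_homeomorphic_space by blast
qed

section \<open>The homeomorphisms and the leaves\<close>

lemma subtopology_RP: "subtopology RP_topology RP = RP_topology"
  by (metis subtopology_topspace topspace_RP_topology)

lemma pi_class_mult:
  assumes "P \<in> UTH2_Coefs"
  shows "pi1 P \<in> RP" "pi2 P \<in> H2_Coefs" "P = class_mult (pi1 P) (pi2 P)"
proof -
  obtain L Q where "L \<in> RP" "Q \<in> H2_Coefs" "P = class_mult L Q"
    using assms by (rule UTH2_cases)
  then show "pi1 P \<in> RP" "pi2 P \<in> H2_Coefs" "P = class_mult (pi1 P) (pi2 P)"
    by (simp_all add: pi1_class_mult pi2_class_mult)
qed

lemma R3_eq:
  assumes "P \<in> UTH2_Coefs"
  shows "R3 P = unordered_roots (R1 (pi1 P), R2 (pi2 P))"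
  using R3_class_mult pi_class_mult [OF assms] by metis

lemma factorization_UTH2_iff:
  assumes "P \<in> UTH2_Coefs" "L \<in> RP" "Q \<in> H2_Coefs"
  shows "factorization P L Q \<longleftrightarrow> P = class_mult L Q"
  using assms UTH2_subset_RP H2_subset_RP by (intro factorization_iff) auto

lemma homeomorphic_map_R2:
  "homeomorphic_map (subtopology RP_topology H2_Coefs) (top_of_set H2_Roots) R2"
  using homeomorphic_maps_R2 homeomorphic_map_maps by blast

lemma inj_on_R2: "inj_on R2 H2_Coefs"
  using homeomorphic_imp_injective_map [OF homeomorphic_map_R2] H2_subset_RP
  by (simp add: Int_absorb1)

lemma circle_leaf_R2:
  assumes "Q \<in> H2_Coefs"
  shows "circle_leaf (R2 Q) = {P \<in> UTH2_Coefs. pi2 P = Q}"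
proof -
  have "affine_point (R2 Q) \<in> R3 P \<and> affine_point (cnj (R2 Q)) \<in> R3 P \<longleftrightarrow> pi2 P = Q"
    if P: "P \<in> UTH2_Coefs" for P
  proof -
    note pi = pi_class_mult [OF P]
    have Im: "Im (R2 Q) > 0" "Im (R2 (pi2 P)) > 0"
      using R2_in_H2 [OF assms] R2_in_H2 [OF pi(2)] by (simp_all add: H2_Roots_def)
    \<comment> \<open>Roots in opposite half planes differ and real roots are excluded next, so the
      root of \<open>Q\<close> can only match the upper root of \<open>P\<close>.\<close>
    then have "R2 Q \<noteq> cnj (R2 (pi2 P))"
      by (metis cnj.simps(2) less_asym neg_0_less_iff_less)
    moreover have "affine_point (R2 Q) \<noteq> real_point (R1 (pi1 P))"
      "affine_point (cnj (R2 Q)) \<noteq> real_point (R1 (pi1 P))"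
      using Im by (simp_all add: affine_point_neq_real_point [OF R1_in_RP [OF pi(1)]])
    moreover have "R2 Q = R2 (pi2 P) \<longleftrightarrow> Q = pi2 P"
      using inj_on_eq_iff [OF inj_on_R2 assms pi(2)] .
    ultimately show ?thesis
      unfolding R3_eq [OF P] by (auto simp: unordered_roots_def affine_point_inject)
  qed
  then show ?thesis
    unfolding circle_leaf_def by blast
qed

text \<open>Among the three roots of \<open>P\<close> only that of its linear factor is real, and it
  recovers the factor because \<open>R1\<close> is an involution.\<close>

lemma plane_leaf_R1:
  assumes "L \<in> RP"
  shows "plane_leaf (R1 L) = {P \<in> UTH2_Coefs. pi1 P = L}"
proof -
  have "real_point (R1 L) \<in> R3 P \<longleftrightarrow> pi1 P = L" if P: "P \<in> UTH2_Coefs" for P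
  proof -
    note pi = pi_class_mult [OF P]
    have "Im (R2 (pi2 P)) > 0"
      using R2_in_H2 [OF pi(2)] by (simp add: H2_Roots_def)
    then have "affine_point (R2 (pi2 P)) \<noteq> real_point (R1 L)"
      "affine_point (cnj (R2 (pi2 P))) \<noteq> real_point (R1 L)"
      by (simp_all add: affine_point_neq_real_point [OF R1_in_RP [OF assms]])
    moreover have "real_point (R1 L) = real_point (R1 (pi1 P)) \<longleftrightarrow> L = pi1 P"
      unfolding real_point_inject [OF R1_in_RP [OF assms] R1_in_RP [OF pi(1)]]
      using R1_R1 [OF assms] R1_R1 [OF pi(1)] by metis
    ultimately show ?thesis
      unfolding R3_eq [OF P] by (auto simp: unordered_roots_def)
  qed
  then show ?thesis
    unfolding plane_leaf_def by blast
qed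

lemma homeomorphic_map_pi:
  "homeomorphic_map (subtopology RP_topology UTH2_Coefs)
     (prod_topology RP_topology (subtopology RP_topology H2_Coefs)) (\<lambda>P. (pi1 P, pi2 P))"
  using homeomorphic_maps_pi homeomorphic_map_maps by blast

text \<open>The map is a composite of three homeomorphisms: factors of the cubic, their roots, and
  the unit vector at z towards r.\<close>

lemma homeomorphic_map_unit_tangent_vector:
  "homeomorphic_map (subtopology RP_topology UTH2_Coefs) (top_of_set unit_tangent_bundle)
     unit_tangent_vector"
proof -
  have "homeomorphic_maps (prod_topology RP_topology (subtopology RP_topology H2_Coefs))
      (prod_topology RP_topology (top_of_set H2_Roots))
      (\<lambda>(L, Q). (R1 L, R2 Q)) (\<lambda>(r, z). (R1 r, (scaling_class \<circ> form_of_root) z))"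
    unfolding homeomorphic_maps_prod using homeomorphic_maps_R1 homeomorphic_maps_R2 by blast
  then have "homeomorphic_map (prod_topology RP_topology (subtopology RP_topology H2_Coefs))
      (prod_topology RP_topology (top_of_set H2_Roots)) (\<lambda>(L, Q). (R1 L, R2 Q))"
    using homeomorphic_map_maps by blast
  from homeomorphic_map_compose [OF homeomorphic_map_compose [OF homeomorphic_map_pi this]
      homeomorphic_map_unit_tangent_bundle]
  show ?thesis
    by (rule homeomorphic_map_eq) (simp add: unit_tangent_vector_def ideal_direction_def)
qed

section \<open>Restriction of the trivialization to single leaves\<close>

lemma homeomorphic_map_pi1_circle_leaf:
  assumes "Q \<in> H2_Coefs"
  shows "homeomorphic_map (subtopology RP_topology (circle_leaf (R2 Q))) RP_topology pi1"
proof -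
  have "Q \<in> topspace (subtopology RP_topology H2_Coefs)"
    using assms H2_subset_RP by auto
  from homeomorphic_map_fibre_snd [OF homeomorphic_map_pi this]
  show ?thesis
    using UTH2_subset_RP
    by (simp add: circle_leaf_R2 [OF assms] subtopology_subtopology Int_absorb1 Collect_conj_eq)
qed

lemma homeomorphic_map_pi2_plane_leaf:
  assumes "L \<in> RP"
  shows "homeomorphic_map (subtopology RP_topology (plane_leaf (R1 L)))
    (subtopology RP_topology H2_Coefs) pi2"
proof -
  have "L \<in> topspace RP_topology"
    using assms by simp
  from homeomorphic_map_fibre_fst [OF homeomorphic_map_pi this]
  show ?thesis
    using UTH2_subset_RP
    by (simp add: plane_leaf_R1 [OF assms] subtopology_subtopology Int_absorb1 Collect_conj_eq)
qed

lemma unique_factorization: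
  assumes P: "P \<in> UTH2_Coefs"
  shows "\<exists>!(L, Q). L \<in> RP \<and> Q \<in> H2_Coefs \<and> factorization P L Q"
proof (rule ex1I [of _ "(pi1 P, pi2 P)"])
  note pi = pi_class_mult [OF P]
  show "case (pi1 P, pi2 P) of (L, Q) \<Rightarrow> L \<in> RP \<and> Q \<in> H2_Coefs \<and> factorization P L Q"
    unfolding prod.case using factorization_UTH2_iff [OF P pi(1,2)] pi by blast
  fix LQ assume LQ: "case LQ of (L, Q) \<Rightarrow> L \<in> RP \<and> Q \<in> H2_Coefs \<and> factorization P L Q"
  obtain L Q where "LQ = (L, Q)"
    by fastforce
  moreover from this LQ have "L \<in> RP" "Q \<in> H2_Coefs" "P = class_mult L Q"
    using P by (auto simp: factorization_UTH2_iff)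
  ultimately show "LQ = (pi1 P, pi2 P)"
    by (simp add: pi1_class_mult pi2_class_mult)
qed

theorem theorem4p27:
  shows
    "\<comment> \<open>the factors exist and are unique\<close>
     (\<forall>P\<in>UTH2_Coefs. \<exists>!(L, Q). L \<in> RP1_Coefs \<and> Q \<in> H2_Coefs \<and> factorization P L Q) \<and>
     (\<forall>P\<in>UTH2_Coefs. factorization P (pi1 P) (pi2 P)) \<and>
     \<comment> \<open>the roots map factors\<close>
     (R1 \<in> RP1_Coefs \<rightarrow> RP1_Roots) \<and>
     (R2 \<in> H2_Coefs \<rightarrow> H2_Roots) \<and>
     (\<forall>P\<in>UTH2_Coefs.
        R3 P = (unordered_roots \<circ> map_prod R1 R2 \<circ> (\<lambda>P. (pi1 P, pi2 P))) P) \<and>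
     \<comment> \<open>the pair of projections is a homeomorphism trivializing the unit tangent bundle\<close>
     (homeomorphic_map (subtopology RP_topology UTH2_Coefs)
        (prod_topology (subtopology RP_topology RP1_Coefs) (subtopology RP_topology H2_Coefs))
        (\<lambda>P. (pi1 P, pi2 P))) \<and>
     (homeomorphic_map (subtopology RP_topology UTH2_Coefs) (top_of_set unit_tangent_bundle)
        unit_tangent_vector) \<and>
     (homeomorphic_map (subtopology RP_topology H2_Coefs) (top_of_set H2_Roots) R2) \<and>
     (\<forall>P\<in>UTH2_Coefs. fst (unit_tangent_vector P) = R2 (pi2 P) \<and>
        points_to (fst (unit_tangent_vector P)) (snd (unit_tangent_vector P)) (R1 (pi1 P))) \<and>
     \<comment> \<open>the fibres are the leaves of the two foliations\<close>
     (\<forall>Q\<in>H2_Coefs. {P \<in> UTH2_Coefs. pi2 P = Q} = circle_leaf (R2 Q) \<and>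
        homeomorphic_map (subtopology RP_topology (circle_leaf (R2 Q)))
          (subtopology RP_topology RP1_Coefs) pi1 \<and>
        subtopology RP_topology (circle_leaf (R2 Q)) homeomorphic_space
          top_of_set (sphere (0::complex) 1)) \<and>
     (\<forall>L\<in>RP1_Coefs. {P \<in> UTH2_Coefs. pi1 P = L} = plane_leaf (R1 L) \<and>
        homeomorphic_map (subtopology RP_topology (plane_leaf (R1 L)))
          (subtopology RP_topology H2_Coefs) pi2 \<and>
        subtopology RP_topology (plane_leaf (R1 L)) homeomorphic_space top_of_set H2_Roots)"
proof (intro conjI ballI)
  fix P assume P: "P \<in> UTH2_Coefs"
  note pi = pi_class_mult [OF P]
  show "\<exists>!(L, Q). L \<in> RP1_Coefs \<and> Q \<in> H2_Coefs \<and> factorization P L Q"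
    unfolding RP1_Coefs_def using P by (rule unique_factorization)
  show "factorization P (pi1 P) (pi2 P)"
    using factorization_UTH2_iff [OF P pi(1,2)] pi(3) by blast
  show "R3 P = (unordered_roots \<circ> map_prod R1 R2 \<circ> (\<lambda>P. (pi1 P, pi2 P))) P"
    by (simp add: R3_eq [OF P])
  show "fst (unit_tangent_vector P) = R2 (pi2 P)"
    by (simp add: unit_tangent_vector_def)
  have "Im (R2 (pi2 P)) > 0"
    using R2_in_H2 [OF pi(2)] by (simp add: H2_Roots_def)
  then show "points_to (fst (unit_tangent_vector P)) (snd (unit_tangent_vector P)) (R1 (pi1 P))"
    using points_to_ideal_direction [OF _ R1_in_RP [OF pi(1)]]
    by (simp add: unit_tangent_vector_def ideal_direction_def)
next
  show "R1 \<in> RP1_Coefs \<rightarrow> RP1_Roots" "R2 \<in> H2_Coefs \<rightarrow> H2_Roots"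
    by (auto simp: RP1_Coefs_def RP1_Roots_def R1_in_RP R2_in_H2)
  show "homeomorphic_map (subtopology RP_topology UTH2_Coefs)
      (prod_topology (subtopology RP_topology RP1_Coefs) (subtopology RP_topology H2_Coefs))
      (\<lambda>P. (pi1 P, pi2 P))"
    unfolding RP1_Coefs_def subtopology_RP by (rule homeomorphic_map_pi)
  show "homeomorphic_map (subtopology RP_topology UTH2_Coefs) (top_of_set unit_tangent_bundle)
      unit_tangent_vector"
    by (rule homeomorphic_map_unit_tangent_vector)
  show "homeomorphic_map (subtopology RP_topology H2_Coefs) (top_of_set H2_Roots) R2"
    by (rule homeomorphic_map_R2)
next
  fix Q assume Q: "Q \<in> H2_Coefs"
  show "{P \<in> UTH2_Coefs. pi2 P = Q} = circle_leaf (R2 Q)"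
    by (simp add: circle_leaf_R2 [OF Q])
  show "homeomorphic_map (subtopology RP_topology (circle_leaf (R2 Q)))
      (subtopology RP_topology RP1_Coefs) pi1"
    unfolding RP1_Coefs_def subtopology_RP by (rule homeomorphic_map_pi1_circle_leaf [OF Q])
  show "subtopology RP_topology (circle_leaf (R2 Q)) homeomorphic_space top_of_set (sphere (0::complex) 1)"
    by (rule homeomorphic_space_trans [OF homeomorphic_map_imp_homeomorphic_space RP1_homeomorphic_circle])
      (rule homeomorphic_map_pi1_circle_leaf [OF Q])
next
  fix L assume "L \<in> RP1_Coefs"
  then have L: "L \<in> RP"
    by (simp add: RP1_Coefs_def)
  show "{P \<in> UTH2_Coefs. pi1 P = L} = plane_leaf (R1 L)"
    by (simp add: plane_leaf_R1 [OF L])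
  show hom: "homeomorphic_map (subtopology RP_topology (plane_leaf (R1 L)))
      (subtopology RP_topology H2_Coefs) pi2"
    by (rule homeomorphic_map_pi2_plane_leaf [OF L])
  show "subtopology RP_topology (plane_leaf (R1 L)) homeomorphic_space top_of_set H2_Roots"
    using homeomorphic_map_compose [OF hom homeomorphic_map_R2]
    by (rule homeomorphic_map_imp_homeomorphic_space)
qed

end
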